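(* Let $$\mathcal M_q(\lambda):=\sum_{m,n=0}^\infty\frac{q^{\frac12mn-\frac14m^2}\,q^{-\frac12m+\frac14n}\,q^{-\frac12\lambda n}}{[n]_q!\,[m]_q!\,(1-q)^n}\;f^ne^m\,\frac{q^{\frac14(n-m)h}}{([-\lambda+h]_q)_m}.$$ Then the universal fusion matrix $J_q(\lambda)$ satisfies $$\Delta(\mathcal M_q(\lambda))\,J_q(\lambda)=\mathcal M_q(\lambda-h^{(2)})\otimes\mathcal M_q(\lambda);$$ that is, for all $\mathcal U_q$-modules $W,V$, all weight vectors $w\in W$, $v\in V$, and all $\lambda\in\mathbb{C}$ such that $\lambda-\mathrm{wt}(v)$ and $\lambda-\mathrm{wt}(v)-\mathrm{wt}(w)$ are not in $\mathbb{Z}_{\ge0}+\frac{2\pi i}{\ln q}\mathbb{Z}$, $$\mathcal M_q(\lambda)\cdot\bigl(J_q(\lambda)\cdot(w\otimes v)\bigr)=\bigl(\mathcal M_q(\lambda-\mathrm{wt}(v))\cdot w\bigr)\otimes\bigl(\mathcal M_q(\lambda)\cdot v\bigr).$$ Moreover $$\mathcal M_q(\lambda)=E_q\bigl(q^{\frac14-\frac12\lambda}fq^{\frac14h}\bigr)\;\mathcal A_q\bigl(q^{-\lambda+h},\,(1-q)^2q^{-\frac54-\frac12\lambda}eq^{\frac14h}\bigr),$$ where the two arguments $x,y$ of $\mathcal A_q$ satisfy $xy=q^2yx$.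
   Context: Fix $0<q<1$, $q^z:=\exp(z\ln q)$. Notation: $[a]_q:=\frac{q^{a/2}-q^{-a/2}}{q^{1/2}-q^{-1/2}}$, $[k]_q!:=\prod_{i=1}^k[i]_q$, $([a]_q)_k:=\prod_{i=0}^{k-1}[a+i]_q$, $(a;q)_k:=\prod_{i=0}^{k-1}(1-aq^i)$. As formal series, $E_q(z):=\sum_{n\ge0}\frac{q^{\frac12n(n-1)}z^n}{(q;q)_n}$ and, for $xy=q^2yx$, $\mathcal A_q(x,y):=\sum_{k\ge0}\frac1{(q;q)_k}\,y^k\,\frac1{(x;q)_k}$. $\mathcal U_q=\mathcal U_q(sl(2,\mathbb{C}))$: a $\mathcal U_q$-module is a complex vector space $V$ with linear operators $e,f,h$ such that $V=\bigoplus_\lambda V[\lambda]$, $V[\lambda]=\{v:hv=\lambda v\}$, $eV[\lambda]\subset V[\lambda+2]$, $fV[\lambda]\subset V[\lambda-2]$, $ef-fe$ acts on $V[\lambda]$ as $[\lambda]_q$, and the real parts of the occurring weights are bounded above. A nonzero $v\in V[\lambda]$ is a weight vector, $\mathrm{wt}(v)=\lambda$. Functions of $h$ act on $V[\nu]$ by substituting $\nu$ for $h$; products act right to left. On tensor products, $\mathcal U_q$ acts by $\Delta(h)=h\otimes1+1\otimes h$, $\Delta(e)=e\otimes q^{h/4}+q^{-h/4}\otimes e$, $\Delta(f)=f\otimes q^{h/4}+q^{-h/4}\otimes f$. The universal fusion matrix is $$J_q(\lambda):=\sum_{l\ge0}\frac{q^{-\frac l2(\lambda+1)}}{[l]_q!}f^lq^{lh/4}\otimes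 e^l\frac{q^{lh/4}}{([-\lambda+h]_q)_l},$$ acting on $w\otimes v$ by a finite sum. Interpretation of infinite sums: a generalized element $\sum_{m,n}f^ne^m\psi_{m,n}(h,\lambda)$ acts on a weight vector $u$ of a module $U$ with values in the product $\prod_\nu U[\nu]$ (since $e^mu=0$ for $m$ large, each weight component is a finite sum); it acts on finite sums of weight vectors by linearity. On $U=W\otimes V$, $e,f,h$ act through $\Delta$. The tensor product of an element of $\prod_\nu W[\nu]$ and one of $\prod_\nu V[\nu]$, each with weights obtained from finitely many weights by subtracting elements of $2\mathbb{Z}_{\ge0}$, is viewed in $\prod_\nu(W\otimes V)[\nu]$. The symbol $\mathcal M(\lambda-h^{(2)})\otimes\cdots$ acting on $w\otimes v$ means that $\lambda$ is replaced by $\lambda-\mathrm{wt}(v)$. The last identity in the claim is an identity of generalized elements, i.e. both sides agree on weight vectors $u$ with $\lambda-\mathrm{wt}(u)\notin\mathbb{Z}_{\ge0}+\frac{2\pi i}{\ln q}\mathbb{Z}$. *)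

theory Defs
  imports
    Complex_Main
    "HOL-Library.Groups_Big_Fun"
    "HOL-Library.Poly_Mapping"
    "HOL-Computational_Algebra.Formal_Power_Series"
begin

section \<open>Complex vector spaces\<close>

class complex_vector = ab_group_add +
  fixes scaleC :: "complex \<Rightarrow> 'a \<Rightarrow> 'a"  (infixr \<open>*\<^sub>C\<close> 75)
  assumes scaleC_add_right: "c *\<^sub>C (x + y) = c *\<^sub>C x + c *\<^sub>C y"
    and scaleC_add_left: "(c + d) *\<^sub>C x = c *\<^sub>C x + d *\<^sub>C x"
    and scaleC_scaleC: "c *\<^sub>C d *\<^sub>C x = (c * d) *\<^sub>C x"
    and scaleC_one: "1 *\<^sub>C x = x"

global_interpretation cvec: vector_space "scaleC :: complex \<Rightarrow> 'a \<Rightarrow> 'a::complex_vector"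
  by unfold_locales (rule scaleC_add_right scaleC_add_left scaleC_scaleC scaleC_one)+

abbreviation clinear :: "('a::complex_vector \<Rightarrow> 'b::complex_vector) \<Rightarrow> bool" where
  "clinear \<equiv> Vector_Spaces.linear scaleC scaleC"

definition cbilinear ::
  "('a::complex_vector \<Rightarrow> 'b::complex_vector \<Rightarrow> 'c::complex_vector) \<Rightarrow> bool" where
  "cbilinear b \<longleftrightarrow> (\<forall>x. clinear (b x)) \<and> (\<forall>y. clinear (\<lambda>x. b x y))"

instantiation complex :: complex_vector
begin
definition scaleC_complex :: "complex \<Rightarrow> complex \<Rightarrow> complex" where
  "scaleC_complex c x = c * x"
instance
  by standard (simp_all add: scaleC_complex_def algebra_simps)
end

instantiation poly_mapping :: (type, complex_vector) complex_vector
begin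
definition scaleC_poly_mapping :: "complex \<Rightarrow> ('a \<Rightarrow>\<^sub>0 'b) \<Rightarrow> 'a \<Rightarrow>\<^sub>0 'b" where
  "scaleC_poly_mapping c p = Poly_Mapping.map (scaleC c) p"

lemma lookup_scaleC [simp]: "Poly_Mapping.lookup (c *\<^sub>C p) k = c *\<^sub>C Poly_Mapping.lookup p k"
  for p :: "'a \<Rightarrow>\<^sub>0 'b::complex_vector"
  by (simp add: scaleC_poly_mapping_def map.rep_eq when_def)

instance
  by standard
    (rule poly_mapping_eqI,
     simp add: lookup_add scaleC_add_right scaleC_add_left scaleC_scaleC scaleC_one)+
end


section \<open>The tensor product of two complex vector spaces\<close>

text \<open>The free vector space on pairs, modulo the span of the bilinearity relations.\<close>

definition tensor_relators ::
  "(('a::complex_vector \<times> 'b::complex_vector) \<Rightarrow>\<^sub>0 complex) set" where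
  "tensor_relators =
     {Poly_Mapping.single (x + x', y) 1 - Poly_Mapping.single (x, y) 1
        - Poly_Mapping.single (x', y) 1 | x x' y. True}
   \<union> {Poly_Mapping.single (x, y + y') 1 - Poly_Mapping.single (x, y) 1
        - Poly_Mapping.single (x, y') 1 | x y y'. True}
   \<union> {Poly_Mapping.single (c *\<^sub>C x, y) 1 - c *\<^sub>C Poly_Mapping.single (x, y) 1 | c x y. True}
   \<union> {Poly_Mapping.single (x, c *\<^sub>C y) 1 - c *\<^sub>C Poly_Mapping.single (x, y) 1 | c x y. True}"

definition tensor_rel ::
  "(('a::complex_vector \<times> 'b::complex_vector) \<Rightarrow>\<^sub>0 complex) \<Rightarrow> (('a \<times> 'b) \<Rightarrow>\<^sub>0 complex) \<Rightarrow> bool"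
  where "tensor_rel p p' \<longleftrightarrow> p - p' \<in> cvec.span tensor_relators"

lemma tensor_rel_eqI: "p = p' \<Longrightarrow> tensor_rel p p'"
  by (simp add: tensor_rel_def cvec.span_zero)

lemma equivp_tensor_rel:
  "equivp (tensor_rel ::
     (('a::complex_vector \<times> 'b::complex_vector) \<Rightarrow>\<^sub>0 complex) \<Rightarrow> (('a \<times> 'b) \<Rightarrow>\<^sub>0 complex) \<Rightarrow> bool)"
proof (rule equivpI)
  show "reflp (tensor_rel :: (('a \<times> 'b) \<Rightarrow>\<^sub>0 complex) \<Rightarrow> _)"
    by (rule reflpI) (simp add: tensor_rel_def cvec.span_zero)
  show "symp (tensor_rel :: (('a \<times> 'b) \<Rightarrow>\<^sub>0 complex) \<Rightarrow> _)"
  proof (rule sympI)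
    fix p p' :: "('a \<times> 'b) \<Rightarrow>\<^sub>0 complex"
    assume "tensor_rel p p'"
    then have "- (p - p') \<in> cvec.span tensor_relators"
      unfolding tensor_rel_def by (rule cvec.span_neg)
    then show "tensor_rel p' p" by (simp add: tensor_rel_def)
  qed
  show "transp (tensor_rel :: (('a \<times> 'b) \<Rightarrow>\<^sub>0 complex) \<Rightarrow> _)"
  proof (rule transpI)
    fix p p' p'' :: "('a \<times> 'b) \<Rightarrow>\<^sub>0 complex"
    assume "tensor_rel p p'" "tensor_rel p' p''"
    then have "(p - p') + (p' - p'') \<in> cvec.span tensor_relators"
      unfolding tensor_rel_def by (rule cvec.span_add)
    then show "tensor_rel p p''" by (simp add: tensor_rel_def)
  qed
qed

quotient_type (overloaded) ('a, 'b) tensor = "('a::complex_vector \<times> 'b::complex_vector) \<Rightarrow>\<^sub>0 complex" / tensor_rel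
  by (rule equivp_tensor_rel)

instantiation tensor :: (complex_vector, complex_vector) complex_vector
begin

lift_definition zero_tensor :: "('a, 'b) tensor" is "0" .

lift_definition plus_tensor :: "('a, 'b) tensor \<Rightarrow> ('a, 'b) tensor \<Rightarrow> ('a, 'b) tensor" is "(+)"
  unfolding tensor_rel_def by (drule (1) cvec.span_add) (simp add: algebra_simps)

lift_definition uminus_tensor :: "('a, 'b) tensor \<Rightarrow> ('a, 'b) tensor" is "uminus"
  unfolding tensor_rel_def by (drule cvec.span_neg) (simp add: algebra_simps)

lift_definition minus_tensor :: "('a, 'b) tensor \<Rightarrow> ('a, 'b) tensor \<Rightarrow> ('a, 'b) tensor" is "(-)"
  unfolding tensor_rel_def by (drule (1) cvec.span_diff) (simp add: algebra_simps)

lift_definition scaleC_tensor :: "complex \<Rightarrow> ('a, 'b) tensor \<Rightarrow> ('a, 'b) tensor" is "scaleC"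
  unfolding tensor_rel_def cvec.scale_right_diff_distrib [symmetric] by (rule cvec.span_scale)

instance
  by standard
    (transfer, rule tensor_rel_eqI,
     simp add: scaleC_add_right scaleC_add_left scaleC_scaleC scaleC_one)+

end

lift_definition tens :: "'a::complex_vector \<Rightarrow> 'b::complex_vector \<Rightarrow> ('a, 'b) tensor"  (infixl \<open>\<otimes>\<^sub>t\<close> 76)
  is "\<lambda>x y. Poly_Mapping.single (x, y) 1" .

text \<open>The linear map on the tensor product induced by a bilinear map. It does not depend on the
  representative chosen by \<open>rep_tensor\<close> as soon as \<open>b\<close> is bilinear.\<close>

definition free_lift ::
  "('a::complex_vector \<Rightarrow> 'b::complex_vector \<Rightarrow> 'c::complex_vector)
     \<Rightarrow> (('a \<times> 'b) \<Rightarrow>\<^sub>0 complex) \<Rightarrow> 'c" where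
  "free_lift b p = (\<Sum>z\<in>Poly_Mapping.keys p. Poly_Mapping.lookup p z *\<^sub>C b (fst z) (snd z))"

definition tensor_lift ::
  "('a::complex_vector \<Rightarrow> 'b::complex_vector \<Rightarrow> 'c::complex_vector) \<Rightarrow> ('a, 'b) tensor \<Rightarrow> 'c" where
  "tensor_lift b t = free_lift b (rep_tensor t)"

definition tensor_map ::
  "('a::complex_vector \<Rightarrow> 'c::complex_vector) \<Rightarrow> ('b::complex_vector \<Rightarrow> 'd::complex_vector)
     \<Rightarrow> ('a, 'b) tensor \<Rightarrow> ('c, 'd) tensor" where
  "tensor_map A B = tensor_lift (\<lambda>x y. A x \<otimes>\<^sub>t B y)"

lemma free_lift_superset:
  assumes "finite K" "Poly_Mapping.keys p \<subseteq> K"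
  shows "free_lift b p = (\<Sum>z\<in>K. Poly_Mapping.lookup p z *\<^sub>C b (fst z) (snd z))"
  unfolding free_lift_def
  by (rule sum.mono_neutral_left) (use assms in \<open>auto simp: in_keys_iff\<close>)

lemma clinear_free_lift: "clinear (free_lift b)"
proof
  fix p p' :: "('a \<times> 'b) \<Rightarrow>\<^sub>0 complex" and c
  let ?K = "Poly_Mapping.keys p \<union> Poly_Mapping.keys p'"
  have "Poly_Mapping.keys (p + p') \<subseteq> ?K" by (rule keys_add)
  then show "free_lift b (p + p') = free_lift b p + free_lift b p'"
    by (simp add: free_lift_superset [of ?K] lookup_add cvec.scale_left_distrib sum.distrib)
  have "Poly_Mapping.keys (c *\<^sub>C p) \<subseteq> Poly_Mapping.keys p"
    by (auto simp: in_keys_iff)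
  then show "free_lift b (c *\<^sub>C p) = c *\<^sub>C free_lift b p"
    by (simp add: free_lift_superset [of "Poly_Mapping.keys p"] cvec.scale_sum_right scaleC_complex_def)
qed

lemma free_lift_single [simp]: "free_lift b (Poly_Mapping.single (x, y) c) = c *\<^sub>C b x y"
  by (simp add: free_lift_superset [of "{(x, y)}"])

lemma free_lift_cong:
  assumes b: "cbilinear b" and "tensor_rel p p'"
  shows "free_lift b p = free_lift b p'"
proof -
  interpret L: Vector_Spaces.linear scaleC scaleC "free_lift b"
    by (rule clinear_free_lift)
  interpret B1: Vector_Spaces.linear scaleC scaleC "b x" for x
    using b by (simp add: cbilinear_def)
  interpret B2: Vector_Spaces.linear scaleC scaleC "\<lambda>x. b x y" for y
    using b by (simp add: cbilinear_def)
  have "free_lift b r = 0" if "r \<in> tensor_relators" for r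
    using that unfolding tensor_relators_def
    by (auto simp: L.diff L.scale B1.add B2.add B1.scale B2.scale)
  then have "free_lift b (p - p') = 0"
    by (rule L.eq_0_on_span [OF _ assms(2) [unfolded tensor_rel_def]])
  then show ?thesis by (simp add: L.diff)
qed

lemma tensor_lift_abs:
  assumes "cbilinear b"
  shows "tensor_lift b (abs_tensor p) = free_lift b p"
  unfolding tensor_lift_def
  by (rule free_lift_cong [OF assms])
    (rule Quotient_rep_abs [OF Quotient_tensor], simp add: tensor_rel_def cvec.span_zero)

lemma tensor_lift_tens [simp]:
  assumes "cbilinear b"
  shows "tensor_lift b (x \<otimes>\<^sub>t y) = b x y"
  using assms by (simp add: tens.abs_eq tensor_lift_abs)

lemma clinear_tensor_lift:
  assumes b: "cbilinear b"
  shows "clinear (tensor_lift b)"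
proof -
  interpret L: Vector_Spaces.linear scaleC scaleC "free_lift b"
    by (rule clinear_free_lift)
  show ?thesis
  proof
    fix s t :: "('a, 'b) tensor" and c
    obtain p p' where "s = abs_tensor p" "t = abs_tensor p'"
      using Quotient_abs_rep [OF Quotient_tensor] by metis
    then show "tensor_lift b (s + t) = tensor_lift b s + tensor_lift b t"
      and "tensor_lift b (c *\<^sub>C s) = c *\<^sub>C tensor_lift b s"
      by (simp_all add: plus_tensor.abs_eq scaleC_tensor.abs_eq tensor_lift_abs b L.add L.scale)
  qed
qed

lemma cbilinear_tens: "cbilinear (\<otimes>\<^sub>t)"
  unfolding cbilinear_def
proof (intro conjI allI)
  fix x :: 'a
  show "clinear ((\<otimes>\<^sub>t) x :: 'b \<Rightarrow> _)"
  proof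
    show "x \<otimes>\<^sub>t (y + y') = x \<otimes>\<^sub>t y + x \<otimes>\<^sub>t y'" for y y' :: 'b
      by transfer (force simp: tensor_rel_def tensor_relators_def algebra_simps
          intro!: cvec.span_base)
    show "x \<otimes>\<^sub>t (c *\<^sub>C y) = c *\<^sub>C (x \<otimes>\<^sub>t y)" for c and y :: 'b
      by transfer (force simp: tensor_rel_def tensor_relators_def intro!: cvec.span_base)
  qed
next
  fix y :: 'b
  show "clinear (\<lambda>x :: 'a. x \<otimes>\<^sub>t y)"
  proof
    show "(x + x') \<otimes>\<^sub>t y = x \<otimes>\<^sub>t y + x' \<otimes>\<^sub>t y" for x x' :: 'a
      by transfer (force simp: tensor_rel_def tensor_relators_def algebra_simps
          intro!: cvec.span_base)
    show "(c *\<^sub>C x) \<otimes>\<^sub>t y = c *\<^sub>C (x \<otimes>\<^sub>t y)" for c and x :: 'a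
      by transfer (force simp: tensor_rel_def tensor_relators_def intro!: cvec.span_base)
  qed
qed

lemma cbilinear_tens_comp:
  fixes A :: "'a::complex_vector \<Rightarrow> 'c::complex_vector"
    and B :: "'b::complex_vector \<Rightarrow> 'd::complex_vector"
  assumes "clinear A" "clinear B"
  shows "cbilinear (\<lambda>x y. A x \<otimes>\<^sub>t B y)"
proof -
  interpret A: Vector_Spaces.linear scaleC scaleC A by (rule assms)
  interpret B: Vector_Spaces.linear scaleC scaleC B by (rule assms)
  interpret T1: Vector_Spaces.linear scaleC scaleC "tens x :: 'd \<Rightarrow> ('c, 'd) tensor" for x :: 'c
    by (rule cbilinear_tens [unfolded cbilinear_def, THEN conjunct1, rule_format])
  interpret T2: Vector_Spaces.linear scaleC scaleC "\<lambda>x. tens x y :: ('c, 'd) tensor" for y :: 'd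
    by (rule cbilinear_tens [unfolded cbilinear_def, THEN conjunct2, rule_format])
  show ?thesis
    unfolding cbilinear_def
    by (intro conjI allI; unfold_locales)
      (simp_all add: A.add A.scale B.add B.scale T1.add T1.scale T2.add T2.scale)
qed

lemma tensor_map_tens [simp]:
  "clinear A \<Longrightarrow> clinear B \<Longrightarrow> tensor_map A B (x \<otimes>\<^sub>t y) = A x \<otimes>\<^sub>t B y"
  by (simp add: tensor_map_def cbilinear_tens_comp)


section \<open>q-notation\<close>

definition qpow :: "real \<Rightarrow> complex \<Rightarrow> complex" where
  "qpow q z = exp (z * complex_of_real (ln q))"

definition qnum :: "real \<Rightarrow> complex \<Rightarrow> complex" where
  "qnum q a = (qpow q (a / 2) - qpow q (- a / 2)) / (qpow q (1 / 2) - qpow q (- 1 / 2))"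

definition qfact :: "real \<Rightarrow> nat \<Rightarrow> complex" where
  "qfact q k = (\<Prod>i=1..k. qnum q (of_nat i))"

definition qnum_poch :: "real \<Rightarrow> complex \<Rightarrow> nat \<Rightarrow> complex" where
  "qnum_poch q a k = (\<Prod>i<k. qnum q (a + of_nat i))"

definition qpoch :: "real \<Rightarrow> complex \<Rightarrow> nat \<Rightarrow> complex" where
  "qpoch q a k = (\<Prod>i<k. 1 - a * complex_of_real q ^ i)"

text \<open>The set \<open>\<int>\<^sub>\<ge>\<^sub>0 + (2\<pi>i / ln q) \<int>\<close>.\<close>

definition resonant :: "real \<Rightarrow> complex set" where
  "resonant q =
     {of_nat k + 2 * complex_of_real pi * \<i> / complex_of_real (ln q) * of_int j | k j. True}"


section \<open>Modules\<close>

record 'v uq_ops =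
  E :: "'v \<Rightarrow> 'v"
  F :: "'v \<Rightarrow> 'v"
  H :: "'v \<Rightarrow> 'v"

definition weight_space :: "'v::complex_vector uq_ops \<Rightarrow> complex \<Rightarrow> 'v set" where
  "weight_space M \<nu> = {v. H M v = \<nu> *\<^sub>C v}"

definition weight_vector :: "'v::complex_vector uq_ops \<Rightarrow> complex \<Rightarrow> 'v \<Rightarrow> bool" where
  "weight_vector M \<nu> v \<longleftrightarrow> v \<in> weight_space M \<nu> \<and> v \<noteq> 0"

text \<open>\<open>c\<close> is the family of homogeneous components of \<open>v\<close>; that the module is the direct sum of its
  weight spaces is expressed in \<open>uq_module\<close> by unique existence of this family.\<close>

definition weight_decomp :: "'v::complex_vector uq_ops \<Rightarrow> 'v \<Rightarrow> (complex \<Rightarrow> 'v) \<Rightarrow> bool" where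
  "weight_decomp M v c \<longleftrightarrow>
     finite {\<nu>. c \<nu> \<noteq> 0} \<and> (\<forall>\<nu>. c \<nu> \<in> weight_space M \<nu>) \<and> v = (\<Sum>\<nu> | c \<nu> \<noteq> 0. c \<nu>)"

definition uq_module :: "real \<Rightarrow> 'v::complex_vector uq_ops \<Rightarrow> bool" where
  "uq_module q M \<longleftrightarrow>
     clinear (E M) \<and> clinear (F M) \<and> clinear (H M) \<and>
     (\<forall>v. \<exists>!c. weight_decomp M v c) \<and>
     (\<forall>\<nu>. E M ` weight_space M \<nu> \<subseteq> weight_space M (\<nu> + 2)) \<and>
     (\<forall>\<nu>. F M ` weight_space M \<nu> \<subseteq> weight_space M (\<nu> - 2)) \<and>
     (\<forall>\<nu>. \<forall>v\<in>weight_space M \<nu>. E M (F M v) - F M (E M v) = qnum q \<nu> *\<^sub>C v) \<and>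
     (\<exists>B. \<forall>\<nu>. weight_space M \<nu> \<noteq> {0} \<longrightarrow> Re \<nu> \<le> B)"

definition weight_proj :: "'v::complex_vector uq_ops \<Rightarrow> complex \<Rightarrow> 'v \<Rightarrow> 'v" where
  "weight_proj M \<nu> v = (THE c. weight_decomp M v c) \<nu>"

text \<open>The operator \<open>\<phi>(h)\<close>. \<open>Sum_any\<close> is the sum over the (here finite) set of nonzero summands.\<close>

definition fun_h :: "'v::complex_vector uq_ops \<Rightarrow> (complex \<Rightarrow> complex) \<Rightarrow> 'v \<Rightarrow> 'v" where
  "fun_h M \<phi> v = Sum_any (\<lambda>\<nu>. \<phi> \<nu> *\<^sub>C weight_proj M \<nu> v)"

definition uq_tensor ::
  "real \<Rightarrow> 'w::complex_vector uq_ops \<Rightarrow> 'v::complex_vector uq_ops \<Rightarrow> ('w, 'v) tensor uq_ops" where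
  "uq_tensor q W V =
     \<lparr>E = (\<lambda>t. tensor_map (E W) (fun_h V (\<lambda>\<nu>. qpow q (\<nu> / 4))) t
              + tensor_map (fun_h W (\<lambda>\<nu>. qpow q (- \<nu> / 4))) (E V) t),
      F = (\<lambda>t. tensor_map (F W) (fun_h V (\<lambda>\<nu>. qpow q (\<nu> / 4))) t
              + tensor_map (fun_h W (\<lambda>\<nu>. qpow q (- \<nu> / 4))) (F V) t),
      H = (\<lambda>t. tensor_map (H W) id t + tensor_map id (H V) t)\<rparr>"


section \<open>Generalized elements\<close>

text \<open>A family \<open>\<psi>\<close> stands for the formal sum of the terms \<open>f^n e^m \<psi>\<^sub>m\<^sub>,\<^sub>n(h)\<close>, the
  parameter \<open>lam\<close> being already fixed. An element of the product of all weight spaces is given by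
  its family of components. In each component of \<open>gen_act\<close> only finitely many summands are
  nonzero: \<open>v\<close> has finitely many weights, \<open>e\<close> is locally nilpotent, and \<open>n\<close> is
  determined by \<open>m\<close>, \<open>\<nu>\<close> and the weight of the component of \<open>v\<close>.\<close>

type_synonym gen_elem = "nat \<Rightarrow> nat \<Rightarrow> complex \<Rightarrow> complex"

definition gen_act :: "'v::complex_vector uq_ops \<Rightarrow> gen_elem \<Rightarrow> 'v \<Rightarrow> complex \<Rightarrow> 'v" where
  "gen_act M \<psi> v \<nu> =
     Sum_any (\<lambda>(m, n). weight_proj M \<nu> ((F M ^^ n) ((E M ^^ m) (fun_h M (\<psi> m n) v))))"

text \<open>Tensor product of elements of \<open>\<Prod>W[\<nu>]\<close> and \<open>\<Prod>V[\<nu>]\<close>; the sum is finite if the weights of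
  each factor lie in finitely many cones \<open>\<mu> - 2\<nat>\<close>.\<close>

definition prod_tens ::
  "(complex \<Rightarrow> 'w::complex_vector) \<Rightarrow> (complex \<Rightarrow> 'v::complex_vector) \<Rightarrow> complex \<Rightarrow> ('w, 'v) tensor"
  where "prod_tens a b \<nu> = Sum_any (\<lambda>\<alpha>. a \<alpha> \<otimes>\<^sub>t b (\<nu> - \<alpha>))"

definition Mq :: "real \<Rightarrow> complex \<Rightarrow> gen_elem" where
  "Mq q lam m n h =
     qpow q (of_nat m * of_nat n / 2 - (of_nat m)\<^sup>2 / 4) * qpow q (- of_nat m / 2 + of_nat n / 4)
       * qpow q (- lam * of_nat n / 2)
     / (qfact q n * qfact q m * (1 - complex_of_real q) ^ n)
     * (qpow q ((of_nat n - of_nat m) * h / 4) / qnum_poch q (- lam + h) m)"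

definition Jq ::
  "real \<Rightarrow> complex \<Rightarrow> 'w::complex_vector uq_ops \<Rightarrow> 'v::complex_vector uq_ops
     \<Rightarrow> ('w, 'v) tensor \<Rightarrow> ('w, 'v) tensor" where
  "Jq q lam W V t =
     Sum_any (\<lambda>l. (qpow q (- (of_nat l / 2) * (lam + 1)) / qfact q l) *\<^sub>C
       tensor_map
         ((F W ^^ l) \<circ> fun_h W (\<lambda>h. qpow q (of_nat l * h / 4)))
         ((E V ^^ l) \<circ> fun_h V (\<lambda>h. qpow q (of_nat l * h / 4) / qnum_poch q (- lam + h) l))
         t)"

definition Eq_series :: "real \<Rightarrow> complex fps" where
  "Eq_series q =
     Abs_fps (\<lambda>n. qpow q (of_nat n * (of_nat n - 1) / 2) / qpoch q (complex_of_real q) n)"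

text \<open>A formal power series evaluated at an operator \<open>X\<close> that lowers weights by a nonzero amount.\<close>

definition fps_act ::
  "'v::complex_vector uq_ops \<Rightarrow> complex fps \<Rightarrow> ('v \<Rightarrow> 'v) \<Rightarrow> 'v \<Rightarrow> complex \<Rightarrow> 'v" where
  "fps_act M S X v \<nu> = Sum_any (\<lambda>n. weight_proj M \<nu> (fps_nth S n *\<^sub>C (X ^^ n) v))"

text \<open>The series \<open>A\<^sub>q(x, y)\<close> for \<open>x = \<xi>(h)\<close> a function of \<open>h\<close>, so that \<open>1/(x;q)\<^sub>k\<close> is one too, and
  \<open>y\<close> a locally nilpotent operator.\<close>

definition Aq_act ::
  "real \<Rightarrow> 'v::complex_vector uq_ops \<Rightarrow> (complex \<Rightarrow> complex) \<Rightarrow> ('v \<Rightarrow> 'v) \<Rightarrow> 'v \<Rightarrow> 'v" where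
  "Aq_act q M \<xi> y v =
     Sum_any (\<lambda>k. (1 / qpoch q (complex_of_real q) k) *\<^sub>C
       (y ^^ k) (fun_h M (\<lambda>h. 1 / qpoch q (\<xi> h) k) v))"

text \<open>The argument of \<open>E\<^sub>q\<close> and the arguments \<open>x\<close>, \<open>y\<close> of \<open>A\<^sub>q\<close> in the factorization of \<open>Mq\<close>;
  \<open>arg_x\<close> is the function of \<open>h\<close>, the operator being \<open>fun_h M (arg_x q lam)\<close>.\<close>

definition arg_f :: "real \<Rightarrow> complex \<Rightarrow> 'v::complex_vector uq_ops \<Rightarrow> 'v \<Rightarrow> 'v" where
  "arg_f q lam M v = qpow q (1 / 4 - lam / 2) *\<^sub>C F M (fun_h M (\<lambda>h. qpow q (h / 4)) v)"

definition arg_x :: "real \<Rightarrow> complex \<Rightarrow> complex \<Rightarrow> complex" where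
  "arg_x q lam h = qpow q (- lam + h)"

definition arg_y :: "real \<Rightarrow> complex \<Rightarrow> 'v::complex_vector uq_ops \<Rightarrow> 'v \<Rightarrow> 'v" where
  "arg_y q lam M v =
     ((1 - complex_of_real q)\<^sup>2 * qpow q (- 5 / 4 - lam / 2)) *\<^sub>C
       E M (fun_h M (\<lambda>h. qpow q (h / 4)) v)"

end

(*
  Write g and y for the arguments of E_q and of the second slot of A_q, and x = q^(h - lambda).
  Comparing powers of q gives M = E_q(g) A_q(x, y).  On a tensor product both g and y become sums of
  two q-commuting operators, so Delta(M) expands by the q-binomial theorem, and J becomes
  sum_l q^(l(l-1)/2) / ((q;q)_l (z;q)_l) X^l w (x) y^l v with X = g for the parameter lambda - wt(v)
  and z = q^(wt(v) - lambda).  Comparing the coefficients of g^b y^J v in the second factor leaves, for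
  every J, an identity between words X^n P^i X^l in the first factor, where P = y for the
  parameter lambda - wt(v).  It follows by induction on J from E_q(q^J X) = (1 + q^J X) E_q(q^(J+1) X)
  and the commutation relation of X with powers of P.
*)

theory Submission
  imports Defs
begin

section \<open>Linear maps and tensor products\<close>

text \<open>The values of \<open>Mq\<close> are infinite sums, and series with values in a product
  of weight spaces cannot simply be multiplied. Everything is done in one weight \<mu> - 2N at a
  time: the exponent of \<open>f\<close> is then that of \<open>e\<close> plus N. Since N may be
  negative, indices are integers and terms with a negative exponent are zero. All sums are cut off
  by nilpotency bounds taken from the two factors. The parameter enters \<open>arg_f\<close> and
  \<open>arg_y\<close> only through a scalar, and the coproduct replaces it in the first factor by
  its difference with the weight of the second vector. Next to y^J v, of weight \<nu> + 2J, the
  series in the first factor is therefore E_q(q^J X), whereas the target contains E_q(X). Induction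
  on J accounts for this difference: the X of the new factor 1 + q^J X is moved to the right through
  P^i until it joins X^l. The lower words produced on the way change the coefficients exactly so
  that those for J + 1 appear, times (1 - q^(J+1)) (1 - z q^J). The product of these factors is the
  denominator (q;q)_J (z;q)_J in the second factor of the target.\<close>

lemma clinearI:
  assumes "\<And>x y. f (x + y) = f x + f y" "\<And>c x. f (c *\<^sub>C x) = c *\<^sub>C f x"
  shows "clinear f"
  by unfold_locales (simp_all add: assms)

lemma clinearD:
  assumes "clinear f"
  shows clinear_add: "f (x + y) = f x + f y"
    and clinear_scale: "f (c *\<^sub>C x) = c *\<^sub>C f x"
    and clinear_zero: "f 0 = 0"
    and clinear_diff: "f (x - y) = f x - f y"
    and clinear_sum: "f (sum h A) = (\<Sum>a\<in>A. f (h a))"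
proof -
  interpret Vector_Spaces.linear scaleC scaleC f by (rule assms)
  show "f (x + y) = f x + f y" "f (c *\<^sub>C x) = c *\<^sub>C f x" "f 0 = 0" "f (x - y) = f x - f y"
    "f (sum h A) = (\<Sum>a\<in>A. f (h a))"
    by (simp_all add: add scale diff sum)
qed

lemma clinear_compose: "clinear f \<Longrightarrow> clinear g \<Longrightarrow> clinear (\<lambda>x. f (g x))"
  by (rule clinearI) (simp_all add: clinearD)

lemma clinear_plus: "clinear f \<Longrightarrow> clinear g \<Longrightarrow> clinear (\<lambda>x. f x + g x)"
  by (rule clinearI) (simp_all add: clinearD cvec.scale_right_distrib)

lemma clinear_minus: "clinear f \<Longrightarrow> clinear g \<Longrightarrow> clinear (\<lambda>x. f x - g x)"
  by (rule clinearI) (simp_all add: clinearD cvec.scale_right_diff_distrib)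

lemma clinear_scaled: "clinear f \<Longrightarrow> clinear (\<lambda>x. c *\<^sub>C f x)"
  by (rule clinearI) (simp_all add: clinearD cvec.scale_right_distrib mult.commute)

lemma clinear_ident: "clinear (\<lambda>x. x)" "clinear id"
  by (rule clinearI; simp)+

lemma clinear_funpow:
  fixes f :: "'a::complex_vector \<Rightarrow> 'a"
  assumes "clinear f"
  shows "clinear (f ^^ n)"
  by (rule clinearI; induction n) (simp_all add: clinearD [OF assms])

lemma clinear_eq_on_span:
  assumes "clinear f" "clinear g" "\<And>x. x \<in> S \<Longrightarrow> f x = g x" "x \<in> cvec.span S"
  shows "f x = g x"
  using assms(4)
proof (induction rule: cvec.span_induct_alt)
  case (step c b x)
  then show ?case using assms(3) by (simp add: clinearD [OF assms(1)] clinearD [OF assms(2)])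
qed (simp add: clinearD [OF assms(1)] clinearD [OF assms(2)])

lemma clinear_tens: "clinear (\<lambda>y. x \<otimes>\<^sub>t y)" "clinear (\<lambda>x. x \<otimes>\<^sub>t y)"
  using cbilinear_tens [unfolded cbilinear_def] by blast+

text \<open>Facts 1 to 5 concern the second argument, 6 to 10 the first, each in the order add,
  scale, zero, diff, sum; later proofs pick single ones by number.\<close>

lemmas tens_linear = clinearD [OF clinear_tens(1)] clinearD [OF clinear_tens(2)]

lemma clinear_tensor_map: "clinear f \<Longrightarrow> clinear g \<Longrightarrow> clinear (tensor_map f g)"
  unfolding tensor_map_def by (intro clinear_tensor_lift cbilinear_tens_comp)

text \<open>A tensor is the class of a finitely supported function on pairs, and inserting a new key
  adds a multiple of one pure tensor. Hence linear maps on a tensor product are determined by pure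
  tensors.\<close>

lemma span_pure_tensors: "t \<in> cvec.span {x \<otimes>\<^sub>t y | x y. True}"
proof -
  obtain p where p: "t = abs_tensor p"
    using Quotient_abs_rep [OF Quotient_tensor] by metis
  have "abs_tensor p \<in> cvec.span {x \<otimes>\<^sub>t y | x y. True}"
  proof (induction p rule: update_induct)
    case const
    show ?case by (simp add: zero_tensor.abs_eq [symmetric] cvec.span_zero)
  next
    case (update f k c)
    have "Poly_Mapping.update k c f = c *\<^sub>C Poly_Mapping.single k 1 + f"
      using update.hyps
      by (intro poly_mapping_eqI)
        (auto simp: lookup_single lookup_update lookup_add when_def scaleC_complex_def in_keys_iff)
    then have eq: "abs_tensor (Poly_Mapping.update k c f) = c *\<^sub>C (fst k \<otimes>\<^sub>t snd k) + abs_tensor f"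
      by (simp add: scaleC_tensor.abs_eq tens.abs_eq plus_tensor.abs_eq)
    have "fst k \<otimes>\<^sub>t snd k \<in> {x \<otimes>\<^sub>t y | x y. True}" by blast
    then show ?case unfolding eq
      by (intro cvec.span_add cvec.span_scale update.IH) (rule cvec.span_base)
  qed
  then show ?thesis by (simp add: p)
qed

section \<open>Weight decompositions\<close>

lemma weight_space_closed:
  assumes "clinear (H M)"
  shows "0 \<in> weight_space M \<nu>"
    and "v \<in> weight_space M \<nu> \<Longrightarrow> v' \<in> weight_space M \<nu> \<Longrightarrow> v + v' \<in> weight_space M \<nu>"
    and "v \<in> weight_space M \<nu> \<Longrightarrow> v' \<in> weight_space M \<nu> \<Longrightarrow> v - v' \<in> weight_space M \<nu>"
    and "v \<in> weight_space M \<nu> \<Longrightarrow> c *\<^sub>C v \<in> weight_space M \<nu>"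
  by (auto simp: weight_space_def clinearD [OF assms] cvec.scale_right_distrib
      cvec.scale_right_diff_distrib mult.commute)

text \<open>Applying \<open>H\<close> minus \<kappa> to the relation removes the \<kappa>-component
  and multiplies every other one by a nonzero number, which leaves a shorter relation.\<close>

lemma weight_vectors_independent:
  assumes H: "clinear (H M)" and "finite S" and "\<And>\<nu>. \<nu> \<in> S \<Longrightarrow> c \<nu> \<in> weight_space M \<nu>"
    and "(\<Sum>\<nu>\<in>S. c \<nu>) = 0" and "\<nu> \<in> S"
  shows "c \<nu> = 0"
  using assms(2-)
proof (induction S arbitrary: c \<nu> rule: finite_induct)
  case (insert \<kappa> S)
  let ?d = "\<lambda>\<nu>. (\<nu> - \<kappa>) *\<^sub>C c \<nu>"
  have Hc: "H M (c \<nu>) = \<nu> *\<^sub>C c \<nu>" if "\<nu> \<in> insert \<kappa> S" for \<nu>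
    using insert.prems(1) that by (simp add: weight_space_def)
  have "0 = H M (\<Sum>\<nu>\<in>insert \<kappa> S. c \<nu>) - \<kappa> *\<^sub>C (\<Sum>\<nu>\<in>insert \<kappa> S. c \<nu>)"
    by (simp only: insert.prems(2) clinear_zero [OF H] cvec.scale_zero_right diff_zero)
  also have "\<dots> = (\<Sum>\<nu>\<in>insert \<kappa> S. \<nu> *\<^sub>C c \<nu>) - (\<Sum>\<nu>\<in>insert \<kappa> S. \<kappa> *\<^sub>C c \<nu>)"
    by (simp only: clinear_sum [OF H] cvec.scale_sum_right sum.cong [OF refl Hc])
  also have "\<dots> = (\<Sum>\<nu>\<in>insert \<kappa> S. ?d \<nu>)"
    by (simp only: sum_subtractf [symmetric] cvec.scale_left_diff_distrib)
  also have "\<dots> = (\<Sum>\<nu>\<in>S. ?d \<nu>)"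
    using insert.hyps by simp
  finally have "(\<Sum>\<nu>\<in>S. ?d \<nu>) = 0" by simp
  then have "?d \<nu> = 0" if "\<nu> \<in> S" for \<nu>
    using insert.IH [of ?d \<nu>] insert.prems(1) that weight_space_closed(4) [OF H] by blast
  then have S0: "c \<nu> = 0" if "\<nu> \<in> S" for \<nu>
    using that insert.hyps by (auto simp: cvec.scale_eq_0_iff)
  then have "c \<kappa> = 0" using insert.prems(2) insert.hyps by simp
  with S0 show ?case using insert.prems(3) by blast
qed simp

lemma weight_decomp_unique:
  assumes H: "clinear (H M)" and c: "weight_decomp M v c" and d: "weight_decomp M v d"
  shows "c = d"
proof
  fix \<kappa>
  \<comment> \<open>\<kappa> is added so that it lies in the index set even if both components
    vanish there.\<close>
  let ?S = "insert \<kappa> ({\<nu>. c \<nu> \<noteq> 0} \<union> {\<nu>. d \<nu> \<noteq> 0})"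
  have fin: "finite ?S" using c d by (simp add: weight_decomp_def)
  have "(\<Sum>\<nu>\<in>?S. c \<nu>) = (\<Sum>\<nu> | c \<nu> \<noteq> 0. c \<nu>)" "(\<Sum>\<nu>\<in>?S. d \<nu>) = (\<Sum>\<nu> | d \<nu> \<noteq> 0. d \<nu>)"
    by (rule sum.mono_neutral_right [OF fin]; blast)+
  then have "(\<Sum>\<nu>\<in>?S. c \<nu>) = v" "(\<Sum>\<nu>\<in>?S. d \<nu>) = v"
    using c d unfolding weight_decomp_def by simp_all
  then have "(\<Sum>\<nu>\<in>?S. c \<nu> - d \<nu>) = 0"
    unfolding sum_subtractf by simp
  then have "c \<kappa> - d \<kappa> = 0"
    using c d by (intro weight_vectors_independent [OF H fin, of "\<lambda>\<nu>. c \<nu> - d \<nu>"])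
      (auto simp: weight_decomp_def intro!: weight_space_closed(3) [OF H])
  then show "c \<kappa> = d \<kappa>" by simp
qed

text \<open>The family may vanish at points of \<open>S\<close>, so the exact support of a sum or a
  multiple never has to be determined.\<close>

lemma weight_decomp_superset:
  assumes "finite S" "\<And>\<nu>. c \<nu> \<in> weight_space M \<nu>" "\<And>\<nu>. \<nu> \<notin> S \<Longrightarrow> c \<nu> = 0" "v = (\<Sum>\<nu>\<in>S. c \<nu>)"
  shows "weight_decomp M v c"
proof -
  have sub: "{\<nu>. c \<nu> \<noteq> 0} \<subseteq> S" using assms(3) by blast
  then have "(\<Sum>\<nu>\<in>S. c \<nu>) = (\<Sum>\<nu> | c \<nu> \<noteq> 0. c \<nu>)"
    using assms(1) by (intro sum.mono_neutral_right) auto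
  then show ?thesis
    using finite_subset [OF sub assms(1)] assms by (simp add: weight_decomp_def)
qed

lemma weight_decomp_add:
  assumes H: "clinear (H M)" and c: "weight_decomp M v c" and d: "weight_decomp M v' d"
  shows "weight_decomp M (v + v') (\<lambda>\<nu>. c \<nu> + d \<nu>)"
proof -
  let ?S = "{\<nu>. c \<nu> \<noteq> 0} \<union> {\<nu>. d \<nu> \<noteq> 0}"
  have fin: "finite ?S" using c d by (simp add: weight_decomp_def)
  have "(\<Sum>\<nu>\<in>?S. c \<nu>) = (\<Sum>\<nu> | c \<nu> \<noteq> 0. c \<nu>)" "(\<Sum>\<nu>\<in>?S. d \<nu>) = (\<Sum>\<nu> | d \<nu> \<noteq> 0. d \<nu>)"
    by (rule sum.mono_neutral_right [OF fin]; blast)+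
  then have "v = (\<Sum>\<nu>\<in>?S. c \<nu>)" "v' = (\<Sum>\<nu>\<in>?S. d \<nu>)"
    using c d unfolding weight_decomp_def by simp_all
  then have "v + v' = (\<Sum>\<nu>\<in>?S. c \<nu> + d \<nu>)"
    by (simp only: sum.distrib)
  then show ?thesis using fin c d
    by (intro weight_decomp_superset [of ?S])
      (auto simp: weight_decomp_def intro!: weight_space_closed(2) [OF H])
qed

lemma weight_decomp_scale:
  assumes H: "clinear (H M)" and c: "weight_decomp M v c"
  shows "weight_decomp M (a *\<^sub>C v) (\<lambda>\<nu>. a *\<^sub>C c \<nu>)"
  using c
  by (intro weight_decomp_superset [of "{\<nu>. c \<nu> \<noteq> 0}"])
    (auto simp: weight_decomp_def cvec.scale_sum_right intro!: weight_space_closed(4) [OF H])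

lemma weight_decomp_homogeneous:
  assumes H: "clinear (H M)" and "v \<in> weight_space M \<nu>"
  shows "weight_decomp M v (\<lambda>\<kappa>. if \<kappa> = \<nu> then v else 0)"
  using assms by (intro weight_decomp_superset [of "{\<nu>}"]) (auto simp: weight_space_closed)

text \<open>This gives the tensor product its grading: vectors with a decomposition are closed under
  linear combinations, so a spanning set of weight vectors suffices, and uniqueness is the
  independence of eigenvectors.\<close>

lemma weight_decomp_ex1I:
  assumes H: "clinear (H M)" and "\<And>v. v \<in> cvec.span (\<Union>\<nu>. weight_space M \<nu>)"
  shows "\<exists>!c. weight_decomp M v c"
proof -
  have "\<exists>c. weight_decomp M v c"
    using assms(2) [of v]
  proof (induction rule: cvec.span_induct_alt)
    case base
    show ?case
      using weight_decomp_homogeneous [OF H weight_space_closed(1) [OF H]] by blast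
  next
    case (step a x v)
    then obtain \<nu> c where "x \<in> weight_space M \<nu>" "weight_decomp M v c" by blast
    then show ?case
      using weight_decomp_add [OF H weight_decomp_scale [OF H weight_decomp_homogeneous [OF H]]]
      by (intro exI)
  qed
  then show ?thesis using weight_decomp_unique [OF H] by blast
qed

text \<open>These axioms pass from two factors to their tensor product. Local nilpotency of
  \<open>E\<close> is treated apart and derived in the factors, where the weights are
  bounded.\<close>

locale weight_graded =
  fixes M :: "'v::complex_vector uq_ops"
  assumes linear_E: "clinear (E M)" and linear_F: "clinear (F M)" and linear_H: "clinear (H M)"
    and ex1_decomp: "\<exists>!c. weight_decomp M v c"
    and E_weight: "v \<in> weight_space M \<nu> \<Longrightarrow> E M v \<in> weight_space M (\<nu> + 2)"
    and F_weight: "v \<in> weight_space M \<nu> \<Longrightarrow> F M v \<in> weight_space M (\<nu> - 2)"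
begin

lemmas weight_scale = weight_space_closed(4) [OF linear_H]

lemma weight_sum: "(\<And>a. a \<in> A \<Longrightarrow> f a \<in> weight_space M \<nu>) \<Longrightarrow> sum f A \<in> weight_space M \<nu>"
  by (induction A rule: infinite_finite_induct) (auto simp: weight_space_closed [OF linear_H])

lemma weight_proj_eq: "weight_decomp M v c \<Longrightarrow> weight_proj M \<nu> v = c \<nu>"
  unfolding weight_proj_def using ex1_decomp by (metis the1_equality)

lemma decomp_weight_proj: "weight_decomp M v (\<lambda>\<nu>. weight_proj M \<nu> v)"
  unfolding weight_proj_def using theI' [OF ex1_decomp] by simp

lemma clinear_weight_proj: "clinear (weight_proj M \<nu>)"
  by (rule clinearI)
    (rule weight_proj_eq [OF weight_decomp_add [OF linear_H decomp_weight_proj decomp_weight_proj]]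
      weight_proj_eq [OF weight_decomp_scale [OF linear_H decomp_weight_proj]])+

lemma weight_proj_homogeneous:
  "v \<in> weight_space M \<nu> \<Longrightarrow> weight_proj M \<kappa> v = (if \<kappa> = \<nu> then v else 0)"
  using weight_proj_eq [OF weight_decomp_homogeneous [OF linear_H]] .

lemma span_weight_spaces: "v \<in> cvec.span (\<Union>\<nu>. weight_space M \<nu>)"
proof -
  have "(\<Sum>\<nu> | weight_proj M \<nu> v \<noteq> 0. weight_proj M \<nu> v) \<in> cvec.span (\<Union>\<nu>. weight_space M \<nu>)"
    using decomp_weight_proj [of v]
    by (intro cvec.span_sum cvec.span_base) (auto simp: weight_decomp_def)
  then show ?thesis
    using decomp_weight_proj [of v] by (simp add: weight_decomp_def)
qed

lemma clinear_eqI: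
  assumes "clinear f" "clinear g" "\<And>\<nu> v. v \<in> weight_space M \<nu> \<Longrightarrow> f v = g v"
  shows "f v = g v"
  by (rule clinear_eq_on_span [OF assms(1,2) _ span_weight_spaces]) (use assms(3) in blast)

lemma fun_h_superset:
  assumes "finite S" "\<And>\<nu>. \<nu> \<notin> S \<Longrightarrow> weight_proj M \<nu> v = 0"
  shows "fun_h M \<phi> v = (\<Sum>\<nu>\<in>S. \<phi> \<nu> *\<^sub>C weight_proj M \<nu> v)"
  unfolding fun_h_def using assms by (intro Sum_any.expand_superset) auto

lemma fun_h_weight: "v \<in> weight_space M \<nu> \<Longrightarrow> fun_h M \<phi> v = \<phi> \<nu> *\<^sub>C v"
  by (subst fun_h_superset [of "{\<nu>}"]) (auto simp: weight_proj_homogeneous)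

lemma clinear_fun_h: "clinear (fun_h M \<phi>)"
proof (rule clinearI)
  note fin = decomp_weight_proj [unfolded weight_decomp_def, THEN conjunct1]
  fix v v' c
  let ?S = "{\<nu>. weight_proj M \<nu> v \<noteq> 0} \<union> {\<nu>. weight_proj M \<nu> v' \<noteq> 0}"
  have S: "finite ?S" using fin by simp
  show "fun_h M \<phi> (v + v') = fun_h M \<phi> v + fun_h M \<phi> v'"
    using S by (subst (1 2 3) fun_h_superset [of ?S])
      (auto simp: clinearD [OF clinear_weight_proj] cvec.scale_right_distrib sum.distrib)
  show "fun_h M \<phi> (c *\<^sub>C v) = c *\<^sub>C fun_h M \<phi> v"
    using S by (subst (1 2) fun_h_superset [of ?S])
      (auto simp: clinearD [OF clinear_weight_proj] cvec.scale_sum_right mult.commute)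
qed

end

lemma uq_module_graded: "uq_module q M \<Longrightarrow> weight_graded M"
  unfolding uq_module_def weight_graded_def by (simp add: image_subset_iff)

text \<open>Real parts of weights are bounded above and grow by 2 with each m. The bound depends on
  \<mu> alone, so it serves all vectors of a weight space.\<close>

lemma weight_space_eventually_zero:
  assumes "uq_module q M"
  obtains N where "\<And>m s. m \<ge> N \<Longrightarrow> s \<in> weight_space M (\<mu> + 2 * of_nat m) \<Longrightarrow> s = 0"
proof -
  obtain B where B: "weight_space M \<nu> \<noteq> {0} \<Longrightarrow> Re \<nu> \<le> B" for \<nu>
    using assms [unfolded uq_module_def] by metis
  obtain N :: nat where N: "real N > B - Re \<mu>" using reals_Archimedean2 by blast
  have "s = 0" if m: "m \<ge> N" and s: "s \<in> weight_space M (\<mu> + 2 * of_nat m)" for m s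
  proof (rule ccontr)
    assume "s \<noteq> 0"
    then have "weight_space M (\<mu> + 2 * of_nat m) \<noteq> {0}" using s by blast
    then have "Re (\<mu> + 2 * of_nat m) \<le> B" by (rule B)
    then show False using N m by simp
  qed
  then show thesis by (rule that)
qed

section \<open>The grading of a tensor product\<close>

locale graded_pair = W: weight_graded W + V: weight_graded V
  for W :: "'w::complex_vector uq_ops" and V :: "'v::complex_vector uq_ops"
begin

text \<open>Bilinearity is used one slot at a time: the second argument is decomposed while the
  first is homogeneous, then the first.\<close>

lemma span_weight_tensors:
  "t \<in> cvec.span {x \<otimes>\<^sub>t y | x y \<mu> \<nu>. x \<in> weight_space W \<mu> \<and> y \<in> weight_space V \<nu>}"
    (is "_ \<in> cvec.span ?S")
proof -
  have pure: "x \<otimes>\<^sub>t y \<in> cvec.span ?S" if "x \<in> weight_space W \<mu>" for x y \<mu>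
    using V.span_weight_spaces [of y]
  proof (induction rule: cvec.span_induct_alt)
    case (step c b y)
    then have "x \<otimes>\<^sub>t b \<in> ?S" using that by blast
    then have "x \<otimes>\<^sub>t b \<in> cvec.span ?S" by (rule cvec.span_base)
    with step show ?case
      by (simp only: tens_linear cvec.span_add cvec.span_scale)
  qed (simp add: tens_linear cvec.span_zero)
  have "x \<otimes>\<^sub>t y \<in> cvec.span ?S" for x y
    using W.span_weight_spaces [of x]
  proof (induction rule: cvec.span_induct_alt)
    case (step c b x)
    then have "b \<otimes>\<^sub>t y \<in> cvec.span ?S" using pure by blast
    with step show ?case by (simp only: tens_linear cvec.span_add cvec.span_scale)
  qed (simp add: tens_linear cvec.span_zero)
  then have "{x \<otimes>\<^sub>t y | x y. True} \<subseteq> cvec.span ?S" by blast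
  then show ?thesis using span_pure_tensors cvec.span_minimal cvec.subspace_span by blast
qed

lemma tensor_ops:
  assumes "s \<in> weight_space W \<mu>" "t \<in> weight_space V \<nu>"
  shows "E (uq_tensor q W V) (s \<otimes>\<^sub>t t)
      = qpow q (\<nu> / 4) *\<^sub>C (E W s \<otimes>\<^sub>t t) + qpow q (- \<mu> / 4) *\<^sub>C (s \<otimes>\<^sub>t E V t)"
    and "F (uq_tensor q W V) (s \<otimes>\<^sub>t t)
      = qpow q (\<nu> / 4) *\<^sub>C (F W s \<otimes>\<^sub>t t) + qpow q (- \<mu> / 4) *\<^sub>C (s \<otimes>\<^sub>t F V t)"
    and "H (uq_tensor q W V) (s \<otimes>\<^sub>t t) = (\<mu> + \<nu>) *\<^sub>C (s \<otimes>\<^sub>t t)"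
proof -
  let ?T = "uq_tensor q W V"
  note simps = uq_tensor_def W.linear_E V.linear_E W.linear_F V.linear_F W.linear_H V.linear_H
    W.clinear_fun_h V.clinear_fun_h clinear_ident tens_linear
    W.fun_h_weight [OF assms(1)] V.fun_h_weight [OF assms(2)]
  show "E ?T (s \<otimes>\<^sub>t t)
      = qpow q (\<nu> / 4) *\<^sub>C (E W s \<otimes>\<^sub>t t) + qpow q (- \<mu> / 4) *\<^sub>C (s \<otimes>\<^sub>t E V t)"
    and "F ?T (s \<otimes>\<^sub>t t)
      = qpow q (\<nu> / 4) *\<^sub>C (F W s \<otimes>\<^sub>t t) + qpow q (- \<mu> / 4) *\<^sub>C (s \<otimes>\<^sub>t F V t)"
    by (simp_all add: simps)
  have "H W s = \<mu> *\<^sub>C s" "H V t = \<nu> *\<^sub>C t" using assms by (simp_all add: weight_space_def)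
  then show "H ?T (s \<otimes>\<^sub>t t) = (\<mu> + \<nu>) *\<^sub>C (s \<otimes>\<^sub>t t)"
    by (simp add: simps cvec.scale_left_distrib)
qed

lemma weight_tens:
  "s \<in> weight_space W \<mu> \<Longrightarrow> t \<in> weight_space V \<nu> \<Longrightarrow>
    s \<otimes>\<^sub>t t \<in> weight_space (uq_tensor q W V) (\<mu> + \<nu>)"
  by (simp add: tensor_ops(3) weight_space_def)

lemma clinear_tensor_ops:
  "clinear (E (uq_tensor q W V))" "clinear (F (uq_tensor q W V))" "clinear (H (uq_tensor q W V))"
  by (simp_all add: uq_tensor_def clinear_plus clinear_tensor_map W.linear_E V.linear_E W.linear_F
      V.linear_F W.linear_H V.linear_H W.clinear_fun_h V.clinear_fun_h clinear_ident)

lemma clinear_tensor_eqI: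
  assumes "clinear f" "clinear g"
    and "\<And>\<mu> \<nu> s t. s \<in> weight_space W \<mu> \<Longrightarrow> t \<in> weight_space V \<nu> \<Longrightarrow> f (s \<otimes>\<^sub>t t) = g (s \<otimes>\<^sub>t t)"
  shows "f x = g x"
  by (rule clinear_eq_on_span [OF assms(1,2) _ span_weight_tensors]) (use assms(3) in blast)

text \<open>A weight vector of the tensor product need not be a pure tensor. The weight shifts are
  therefore stated as operator identities HE = EH + 2E and HF = FH - 2F; both sides are linear, so
  it suffices to check them on weight tensors.\<close>

lemma graded_tensor: "weight_graded (uq_tensor q W V)"
proof -
  let ?T = "uq_tensor q W V"
  note lin = clinear_tensor_ops [of q]
  have "{x \<otimes>\<^sub>t y | x y \<mu> \<nu>. x \<in> weight_space W \<mu> \<and> y \<in> weight_space V \<nu>}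
      \<subseteq> (\<Union>\<nu>. weight_space ?T \<nu>)"
    using weight_tens by blast
  then have ex1: "\<exists>!c. weight_decomp ?T v c" for v
    by (intro weight_decomp_ex1I lin) (rule subsetD [OF cvec.span_mono span_weight_tensors])
  have HE: "H ?T (E ?T t) = E ?T (H ?T t) + 2 *\<^sub>C E ?T t" for t
  proof (rule clinear_tensor_eqI [of "\<lambda>t. H ?T (E ?T t)" "\<lambda>t. E ?T (H ?T t) + 2 *\<^sub>C E ?T t"])
    fix s t \<mu> \<nu> assume st: "s \<in> weight_space W \<mu>" "t \<in> weight_space V \<nu>"
    note st' = W.E_weight [OF st(1)] V.E_weight [OF st(2)]
    have "s \<otimes>\<^sub>t E V t \<in> weight_space ?T (\<mu> + \<nu> + 2)"
      "E W s \<otimes>\<^sub>t t \<in> weight_space ?T (\<mu> + \<nu> + 2)"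
      using weight_tens [OF st(1) st'(2), of q] weight_tens [OF st'(1) st(2), of q]
      by (simp_all add: algebra_simps)
    then have "E ?T (s \<otimes>\<^sub>t t) \<in> weight_space ?T (\<mu> + \<nu> + 2)"
      unfolding tensor_ops(1) [OF st] by (intro weight_space_closed lin)
    then show "H ?T (E ?T (s \<otimes>\<^sub>t t)) = E ?T (H ?T (s \<otimes>\<^sub>t t)) + 2 *\<^sub>C E ?T (s \<otimes>\<^sub>t t)"
      unfolding tensor_ops(3) [OF st] weight_space_def
      by (simp only: clinearD [OF lin(1)] mem_Collect_eq cvec.scale_left_distrib)
  qed (rule clinear_compose [OF lin(3,1)]
      clinear_plus [OF clinear_compose [OF lin(1,3)] clinear_scaled [OF lin(1)]])+
  have HF: "H ?T (F ?T t) = F ?T (H ?T t) - 2 *\<^sub>C F ?T t" for t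
  proof (rule clinear_tensor_eqI [of "\<lambda>t. H ?T (F ?T t)" "\<lambda>t. F ?T (H ?T t) - 2 *\<^sub>C F ?T t"])
    fix s t \<mu> \<nu> assume st: "s \<in> weight_space W \<mu>" "t \<in> weight_space V \<nu>"
    note st' = W.F_weight [OF st(1)] V.F_weight [OF st(2)]
    have "s \<otimes>\<^sub>t F V t \<in> weight_space ?T (\<mu> + \<nu> - 2)"
      "F W s \<otimes>\<^sub>t t \<in> weight_space ?T (\<mu> + \<nu> - 2)"
      using weight_tens [OF st(1) st'(2), of q] weight_tens [OF st'(1) st(2), of q]
      by (simp_all add: algebra_simps)
    then have "F ?T (s \<otimes>\<^sub>t t) \<in> weight_space ?T (\<mu> + \<nu> - 2)"
      unfolding tensor_ops(2) [OF st] by (intro weight_space_closed lin)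
    then show "H ?T (F ?T (s \<otimes>\<^sub>t t)) = F ?T (H ?T (s \<otimes>\<^sub>t t)) - 2 *\<^sub>C F ?T (s \<otimes>\<^sub>t t)"
      unfolding tensor_ops(3) [OF st] weight_space_def
      by (simp only: clinearD [OF lin(2)] mem_Collect_eq cvec.scale_left_diff_distrib)
  qed (rule clinear_compose [OF lin(3,2)]
      clinear_minus [OF clinear_compose [OF lin(2,3)] clinear_scaled [OF lin(2)]])+
  show ?thesis
  proof (rule weight_graded.intro)
    show "clinear (E ?T)" "clinear (F ?T)" "clinear (H ?T)" by (rule lin)+
    show "\<exists>!c. weight_decomp ?T v c" for v by (rule ex1)
    fix v \<nu>
    assume "v \<in> weight_space ?T \<nu>"
    then have "H ?T v = \<nu> *\<^sub>C v" by (simp add: weight_space_def)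
    then show "E ?T v \<in> weight_space ?T (\<nu> + 2)" "F ?T v \<in> weight_space ?T (\<nu> - 2)"
      using HE [of v] HF [of v]
      by (simp_all only: weight_space_def clinearD [OF lin(1)] clinearD [OF lin(2)] mem_Collect_eq
          cvec.scale_left_distrib cvec.scale_left_diff_distrib)
  qed
qed

end

section \<open>q-numbers\<close>

lemma qpow_add: "qpow q (a + b) = qpow q a * qpow q b"
  by (simp add: qpow_def exp_add ring_distribs)

lemma qpow_nonzero [simp]: "qpow q a \<noteq> 0"
  by (simp add: qpow_def)

lemma qpow_0 [simp]: "qpow q 0 = 1"
  by (simp add: qpow_def)

lemma qpow_minus: "qpow q (- a) = inverse (qpow q a)"
  by (simp add: qpow_def exp_minus)

lemma qpow_diff: "qpow q (a - b) = qpow q a / qpow q b"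
  by (simp add: qpow_def exp_diff ring_distribs)

lemma qpoch_0 [simp]: "qpoch q a 0 = 1"
  by (simp add: qpoch_def)

lemma qpoch_Suc: "qpoch q a (Suc n) = qpoch q a n * (1 - a * complex_of_real q ^ n)"
  by (simp add: qpoch_def)

definition Eq_coeff :: "real \<Rightarrow> nat \<Rightarrow> complex" where
  "Eq_coeff q n = fps_nth (Eq_series q) n"

lemma Eq_coeff_0 [simp]: "Eq_coeff q 0 = 1"
  by (simp add: Eq_coeff_def Eq_series_def)

locale q_base =
  fixes q :: real
  assumes q_pos: "0 < q" and q_less: "q < 1"
begin

abbreviation (input) cq :: complex where "cq \<equiv> complex_of_real q"

lemma q_nonzero [simp]: "q \<noteq> 0" "q \<noteq> 1"
  using q_pos q_less by auto

lemma cq_power: "cq ^ n = qpow q (of_nat n)"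
proof -
  have "cq = exp (complex_of_real (ln q))"
    using q_pos by (simp add: exp_of_real)
  then show ?thesis by (metis qpow_def exp_of_nat_mult)
qed

lemma cq_power_neq_1: "n > 0 \<Longrightarrow> cq ^ n \<noteq> 1"
  using power_less_one_iff [of q n] q_pos q_less
  by (metis less_irrefl of_real_eq_1_iff of_real_power less_eq_real_def)

lemma cq_nonzero [simp]: "cq \<noteq> 0" "1 - cq \<noteq> 0"
  using q_pos q_less by auto

lemma qpoch_cq_nonzero [simp]: "qpoch q cq n \<noteq> 0"
  using cq_power_neq_1 [of "Suc _"] by (simp add: qpoch_def)

text \<open>If the factor with index k vanishes, then exp((k - lam) ln q) = 1, so (k - lam) ln q is
  an integer multiple of 2 pi \<i> and \<open>lam\<close> is resonant.\<close>

lemma qpoch_nonresonant: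
  assumes "lam \<notin> resonant q"
  shows "qpoch q (qpow q (- lam)) n \<noteq> 0"
proof -
  have "1 - qpow q (- lam) * cq ^ i \<noteq> 0" for i
  proof
    assume "1 - qpow q (- lam) * cq ^ i = 0"
    then have "exp ((of_nat i - lam) * complex_of_real (ln q)) = 1"
      by (simp add: cq_power qpow_def ring_distribs flip: exp_add)
    moreover define z where "z = (of_nat i - lam) * complex_of_real (ln q)"
    ultimately have exp: "exp z = 1" by simp
    then have "exp (Re z) = 1" by (metis norm_exp_eq_Re norm_one)
    moreover have "exp (Re z) * cos (Im z) = 1" using exp by (metis Re_exp one_complex.sel(1))
    ultimately have "Re z = 0" "cos (Im z) = 1" by simp_all
    then obtain j :: int where "z = 2 * complex_of_real pi * of_int j * \<i>"
      unfolding cos_one_2pi_int by (auto simp: complex_eq_iff)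
    then have "(of_nat i - lam) * complex_of_real (ln q) = 2 * complex_of_real pi * of_int j * \<i>"
      by (simp add: z_def)
    moreover have "complex_of_real (ln q) \<noteq> 0" using q_pos q_less by simp
    \<comment> \<open>Solving for \<open>lam\<close> changes the sign of the multiple of the period,
      hence \<open>- j\<close>.\<close>
    ultimately have "lam = of_nat i + 2 * complex_of_real pi * \<i> / complex_of_real (ln q) * of_int (- j)"
      by (simp add: field_simps)
    then have "lam \<in> resonant q" unfolding resonant_def by blast
    then show False using assms by blast
  qed
  then show ?thesis by (simp add: qpoch_def)
qed

text \<open>Coefficient form of E_q(x) - E_q(qx) = x E_q(qx), the property of the series on which
  the induction on J rests.\<close>

lemma Eq_coeff_Suc: "Eq_coeff q (Suc n) * (1 - cq ^ Suc n) = cq ^ n * Eq_coeff q n"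
proof -
  have "qpow q (of_nat (Suc n) * (of_nat (Suc n) - 1) / 2)
      = cq ^ n * qpow q (of_nat n * (of_nat n - 1) / 2)"
    by (simp add: cq_power field_simps flip: qpow_add)
  then show ?thesis
    using cq_power_neq_1 [of "Suc n"]
    by (simp add: Eq_coeff_def Eq_series_def qpoch_Suc field_simps)
qed

text \<open>The symmetric q-number becomes the one-sided 1 - q^a up to a power of q; this links
  \<open>qnum_poch\<close> and \<open>qfact\<close> with \<open>qpoch\<close>.\<close>

lemma qnum_eq: "qnum q a = qpow q ((1 - a) / 2) * (1 - qpow q a) / (1 - cq)"
proof -
  have cq: "cq = qpow q (1/2) * qpow q (1/2)" 
    using cq_power [of 1] by (simp flip: qpow_add)
  have *: "1 - qpow q (1/2) * qpow q (1/2) \<noteq> 0"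
    using cq_nonzero(2) unfolding cq [symmetric] .
  have a: "qpow q a = qpow q (a/2) * qpow q (a/2)"
    by (simp flip: qpow_add)
  have "qpow q (1/2) * qpow q (1/2) - 1 \<noteq> 0" using * by auto
  then have "qpow q (1/2) - inverse (qpow q (1/2)) \<noteq> 0"
    by (simp add: field_simps)
  then show ?thesis
    using * unfolding qnum_def cq a diff_divide_distrib qpow_diff minus_divide_left [symmetric] qpow_minus
    by (simp add: divide_simps) (simp add: algebra_simps)
qed

text \<open>The exponent is the sum of (1 - a - i)/2 over i < m, from the prefactors in
  \<open>qnum_eq\<close>.\<close>

lemma qnum_poch_eq:
  "qnum_poch q a m = qpow q (of_nat m * (1 - a) / 2 - of_nat m * (of_nat m - 1) / 4)
     * qpoch q (qpow q a) m / (1 - cq) ^ m"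
proof (induction m)
  case (Suc m)
  have "qnum_poch q a (Suc m) = qnum_poch q a m * qnum q (a + of_nat m)"
    by (simp add: qnum_poch_def)
  also have "\<dots> = (qpow q (of_nat m * (1 - a) / 2 - of_nat m * (of_nat m - 1) / 4)
      * qpow q ((1 - (a + of_nat m)) / 2)) * (qpoch q (qpow q a) m * (1 - qpow q a * cq ^ m)) / (1
          - cq) ^ Suc m"
    unfolding Suc.IH qnum_eq by (simp add: cq_power qpow_add mult_ac)
  also have "qpow q (of_nat m * (1 - a) / 2 - of_nat m * (of_nat m - 1) / 4)
      * qpow q ((1 - (a + of_nat m)) / 2) = qpow q (of_nat (Suc m) * (1 - a) / 2
          - of_nat (Suc m) * (of_nat (Suc m) - 1) / 4)"
    unfolding qpow_add [symmetric] by (rule arg_cong [of _ _ "qpow q"]) (simp add: field_simps)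
  finally show ?case by (simp add: qpoch_Suc)
qed (simp add: qnum_poch_def)

lemma qfact_eq: "qfact q n = qpow q (- (of_nat n * (of_nat n - 1) / 4)) * qpoch q cq n / (1 - cq) ^ n"
proof -
  have "qfact q n = qnum_poch q 1 n"
    unfolding qfact_def qnum_poch_def
    by (simp only: prod.atLeast_Suc_atMost_Suc_shift One_nat_def) (simp add: prod.atLeast1_atMost_eq)
  then show ?thesis using cq_power [of 1] by (simp add: qnum_poch_eq)
qed

end

section \<open>The factorization of the generalized element\<close>

text \<open>A summand with integer index, so that sums over a fixed weight need no truncated subtraction.\<close>

definition series_term :: "(nat \<Rightarrow> complex) \<Rightarrow> ('v::complex_vector \<Rightarrow> 'v) \<Rightarrow> int \<Rightarrow> 'v \<Rightarrow> 'v" where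
  "series_term c g k v = (if k < 0 then 0 else c (nat k) *\<^sub>C (g ^^ nat k) v)"

lemma clinear_series_term: "clinear g \<Longrightarrow> clinear (series_term c g k)"
  by (rule clinearI)
    (auto simp: series_term_def clinearD [OF clinear_funpow] cvec.scale_right_distrib mult.commute)

lemma series_term_int: "int n = k \<Longrightarrow> series_term c g k v = c n *\<^sub>C (g ^^ n) v"
  by (auto simp: series_term_def)

lemmas series_term_zero = clinear_zero [OF clinear_series_term]

section \<open>The operators \<open>arg_f\<close> and \<open>arg_y\<close> and the action of
  \<open>Mq\<close> on weight vectors\<close>

locale q_graded = q_base q + weight_graded M
  for q :: real and M :: "'v::complex_vector uq_ops"
begin

lemma clinear_arg_f: "clinear (arg_f q lam M)"
  unfolding arg_f_def [abs_def]
  by (rule clinear_scaled [OF clinear_compose [OF linear_F clinear_fun_h]])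

lemma clinear_arg_y: "clinear (arg_y q lam M)"
  unfolding arg_y_def [abs_def]
  by (rule clinear_scaled [OF clinear_compose [OF linear_E clinear_fun_h]])

lemma arg_f_weight_eq:
  "v \<in> weight_space M \<nu> \<Longrightarrow> arg_f q lam M v = qpow q (1 / 4 - lam / 2 + \<nu> / 4) *\<^sub>C F M v"
  by (simp add: arg_f_def fun_h_weight clinearD [OF linear_F] qpow_add)

lemma arg_y_weight_eq:
  "v \<in> weight_space M \<nu> \<Longrightarrow>
    arg_y q lam M v = ((1 - cq)\<^sup>2 * qpow q (- 5 / 4 - lam / 2 + \<nu> / 4)) *\<^sub>C E M v"
  by (simp add: arg_y_def fun_h_weight clinearD [OF linear_E] qpow_add)

lemma arg_f_weight: "v \<in> weight_space M \<nu> \<Longrightarrow> arg_f q lam M v \<in> weight_space M (\<nu> - 2)"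
  by (simp add: arg_f_weight_eq weight_scale F_weight)

lemma arg_y_weight: "v \<in> weight_space M \<nu> \<Longrightarrow> arg_y q lam M v \<in> weight_space M (\<nu> + 2)"
  by (simp add: arg_y_weight_eq weight_scale E_weight)

lemma arg_f_funpow_weight:
  "v \<in> weight_space M \<nu> \<Longrightarrow> (arg_f q lam M ^^ n) v \<in> weight_space M (\<nu> - 2 * of_nat n)"
  by (induction n) (auto simp: algebra_simps dest: arg_f_weight [where lam = lam])

lemma arg_y_funpow_weight:
  "v \<in> weight_space M \<nu> \<Longrightarrow> (arg_y q lam M ^^ n) v \<in> weight_space M (\<nu> + 2 * of_nat n)"
  by (induction n) (auto simp: algebra_simps dest: arg_y_weight [where lam = lam])

text \<open>Application number k, counted from 0, meets the weight \<nu> - 2k, which lowers the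
  exponent by k/2; these losses sum to n(n - 1)/4. For \<open>arg_y\<close> the weight rises and the
  sign is reversed.\<close>

lemma arg_f_funpow:
  assumes v: "v \<in> weight_space M \<nu>"
  shows "(arg_f q lam M ^^ n) v =
    qpow q (of_nat n * (1 / 4 - lam / 2 + \<nu> / 4) - of_nat n * (of_nat n - 1) / 4) *\<^sub>C (F M ^^ n) v"
proof (induction n)
  case (Suc n)
  have "(arg_f q lam M ^^ Suc n) v =
      qpow q (1 / 4 - lam / 2 + (\<nu> - 2 * of_nat n) / 4) *\<^sub>C F M ((arg_f q lam M ^^ n) v)"
    by (simp add: arg_f_weight_eq [OF arg_f_funpow_weight [OF v]])
  also have "\<dots> = (qpow q (1 / 4 - lam / 2 + (\<nu> - 2 * of_nat n) / 4)
      * qpow q (of_nat n * (1 / 4 - lam / 2 + \<nu> / 4) - of_nat n * (of_nat n - 1) / 4))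
        *\<^sub>C (F M ^^ Suc n) v"
    by (simp add: Suc.IH clinearD [OF linear_F])
  also have "qpow q (1 / 4 - lam / 2 + (\<nu> - 2 * of_nat n) / 4)
      * qpow q (of_nat n * (1 / 4 - lam / 2 + \<nu> / 4) - of_nat n * (of_nat n - 1) / 4)
      = qpow q (of_nat (Suc n) * (1 / 4 - lam / 2 + \<nu> / 4)
          - of_nat (Suc n) * (of_nat (Suc n) - 1) / 4)"
    unfolding qpow_add [symmetric] by (rule arg_cong [of _ _ "qpow q"]) (simp add: field_simps)
  finally show ?case .
qed simp

lemma arg_y_funpow:
  assumes v: "v \<in> weight_space M \<nu>"
  shows "(arg_y q lam M ^^ n) v =
    ((1 - cq) ^ (2 * n) *
      qpow q (of_nat n * (- 5 / 4 - lam / 2 + \<nu> / 4) + of_nat n * (of_nat n - 1) / 4)) *\<^sub>C (E M ^^ n) v"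
proof (induction n)
  case (Suc n)
  have "(arg_y q lam M ^^ Suc n) v =
      ((1 - cq)\<^sup>2 * qpow q (- 5 / 4 - lam / 2 + (\<nu> + 2 * of_nat n) / 4)) *\<^sub>C E M ((arg_y q lam M ^^ n) v)"
    by (simp add: arg_y_weight_eq [OF arg_y_funpow_weight [OF v]])
  also have "\<dots> = ((1 - cq) ^ (2 * Suc n) * (qpow q (- 5 / 4 - lam / 2 + (\<nu> + 2 * of_nat n) / 4)
      * qpow q (of_nat n * (- 5 / 4 - lam / 2 + \<nu> / 4) + of_nat n * (of_nat n - 1) / 4)))
        *\<^sub>C (E M ^^ Suc n) v"
    by (simp add: Suc.IH clinearD [OF linear_E] power2_eq_square mult_ac)
  also have "qpow q (- 5 / 4 - lam / 2 + (\<nu> + 2 * of_nat n) / 4)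
      * qpow q (of_nat n * (- 5 / 4 - lam / 2 + \<nu> / 4) + of_nat n * (of_nat n - 1) / 4)
      = qpow q (of_nat (Suc n) * (- 5 / 4 - lam / 2 + \<nu> / 4)
          + of_nat (Suc n) * (of_nat (Suc n) - 1) / 4)"
    unfolding qpow_add [symmetric] by (rule arg_cong [of _ _ "qpow q"]) (simp add: field_simps)
  finally show ?case .
qed simp

text \<open>Since e^m acts first, the power of \<open>arg_f\<close> starts in weight \<mu> + 2m. The
  factor (1 - q)^(2m) stems from \<open>qfact q m\<close> and \<open>qnum_poch\<close> and explains
  the constant (1 - q)^2 in \<open>arg_y\<close>; the one from \<open>qfact q n\<close> cancels (1 -
  q)^n in \<open>Mq\<close>.\<close>

lemma Mq_eq:
  "Mq q lam m n \<mu> = Eq_coeff q n / (qpoch q cq m * qpoch q (qpow q (\<mu> - lam)) m)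
     * qpow q (of_nat n * (1 / 4 - lam / 2 + (\<mu> + 2 * of_nat m) / 4) - of_nat n * (of_nat n - 1) / 4)
     * ((1 - cq) ^ (2 * m)
        * qpow q (of_nat m * (- 5 / 4 - lam / 2 + \<mu> / 4) + of_nat m * (of_nat m - 1) / 4))"
proof -
  let ?A = "qpow q (of_nat m * of_nat n / 2 - (of_nat m)\<^sup>2 / 4)" and ?B
      = "qpow q (- of_nat m / 2 + of_nat n / 4)"
    and ?C = "qpow q (- lam * of_nat n / 2)" and ?D = "qpow q ((of_nat n - of_nat m) * \<mu> / 4)"
    and ?n = "qpow q (- (of_nat n * (of_nat n - 1) / 4))" and ?m
        = "qpow q (- (of_nat m * (of_nat m - 1) / 4))"
    and ?p = "qpow q (of_nat m * (1 - (- lam + \<mu>)) / 2 - of_nat m * (of_nat m - 1) / 4)"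
    and ?e = "qpow q (of_nat n * (of_nat n - 1) / 2)"
    and ?f = "qpow q (of_nat n * (1 / 4 - lam / 2 + (\<mu> + 2 * of_nat m) / 4) - of_nat n * (of_nat n
        - 1) / 4)"
    and ?y = "qpow q (of_nat m * (- 5 / 4 - lam / 2 + \<mu> / 4) + of_nat m * (of_nat m - 1) / 4)"
    and ?qn = "qpoch q cq n" and ?qm = "qpoch q cq m" and ?u = "qpoch q (qpow q (- lam + \<mu>)) m"
  \<comment> \<open>All powers of q are gathered into one equation between exponents.\<close>
  have key: "?A * ?B * ?C * ?D = ?e * ?f * ?y * (?n * ?m * ?p)"
    unfolding qpow_add [symmetric]
    by (rule arg_cong [of _ _ "qpow q"]) (simp add: field_simps power2_eq_square)
  have "Mq q lam m n \<mu> = ?A * ?B * ?C * ?D * (1 - cq) ^ (2 * m) / (?n * ?m * ?p * (?qn * ?qm * ?u))"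
    using q_less by (simp add: Mq_def qfact_eq qnum_poch_eq mult_2 mult_2_right power_add mult_ac)
  also have "\<dots> = ?e * ?f * ?y * (1 - cq) ^ (2 * m) / (?qn * ?qm * ?u)"
    unfolding key by (simp add: mult_ac)
  finally show ?thesis
    by (simp add: Eq_coeff_def Eq_series_def mult_ac)
qed

lemma Mq_term:
  assumes v: "v \<in> weight_space M \<mu>"
  shows "(F M ^^ n) ((E M ^^ m) (fun_h M (Mq q lam m n) v)) =
    (1 / (qpoch q cq m * qpoch q (qpow q (\<mu> - lam)) m)) *\<^sub>C
      Eq_coeff q n *\<^sub>C (arg_f q lam M ^^ n) ((arg_y q lam M ^^ m) v)"
  using v arg_y_funpow_weight [OF v, of m lam]
  by (simp add: fun_h_weight arg_f_funpow arg_y_funpow Mq_eq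
      clinearD [OF clinear_funpow [OF linear_F]] clinearD [OF clinear_funpow [OF linear_E]])

lemma Mq_component:
  assumes v: "v \<in> weight_space M \<mu>"
  shows "weight_proj M \<kappa> ((F M ^^ n) ((E M ^^ m) (fun_h M (Mq q lam m n) v))) =
    (if \<kappa> = \<mu> + 2 * of_nat m - 2 * of_nat n then
      (1 / (qpoch q cq m * qpoch q (qpow q (\<mu> - lam)) m)) *\<^sub>C
      Eq_coeff q n *\<^sub>C (arg_f q lam M ^^ n) ((arg_y q lam M ^^ m) v) else 0)"
  unfolding Mq_term [OF v]
  by (intro weight_proj_homogeneous weight_scale arg_f_funpow_weight arg_y_funpow_weight v)

lemma gen_act_Mq_off:
  assumes v: "v \<in> weight_space M \<mu>" and "\<And>N. \<kappa> \<noteq> \<mu> - 2 * of_int N"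
  shows "gen_act M (Mq q lam) v \<kappa> = 0"
proof -
  have "\<kappa> \<noteq> \<mu> + 2 * of_nat m - 2 * of_nat n" for m n
    using assms(2) [of "int n - int m"] by (simp add: algebra_simps)
  then show ?thesis
    by (simp add: gen_act_def Mq_component [OF v] case_prod_unfold)
qed

text \<open>Coincidence of complex weights becomes an integer equation that determines n from m;
  \<open>N\<close> is negative for weights above \<mu>.\<close>

lemma weight_lattice_eq_iff:
  "\<mu> - 2 * of_int N = \<mu> + 2 * of_nat m - 2 * of_nat n \<longleftrightarrow> int n = int m + N" for \<mu> :: complex
proof -
  have "\<mu> - 2 * of_int N = \<mu> + 2 * of_nat m - 2 * of_nat n \<longleftrightarrow>
      2 * of_int (int n) = (2 * of_int (int m + N) :: complex)"
    by (auto simp: algebra_simps)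
  also have "\<dots> \<longleftrightarrow> int n = int m + N"
    unfolding mult_cancel_left of_int_eq_iff by simp
  finally show ?thesis .
qed

text \<open>In weight \<mu> - 2N only pairs (m, n) on the line n = m + N contribute, so the double
  sum collapses to a sum over m < B.\<close>

lemma gen_act_Mq:
  assumes v: "v \<in> weight_space M \<mu>" and B: "\<And>m. m \<ge> B \<Longrightarrow> (arg_y q lam M ^^ m) v = 0"
  shows "gen_act M (Mq q lam) v (\<mu> - 2 * of_int N) =
    (\<Sum>m<B. (1 / (qpoch q cq m * qpoch q (qpow q (\<mu> - lam)) m)) *\<^sub>C
      series_term (Eq_coeff q) (arg_f q lam M) (int m + N) ((arg_y q lam M ^^ m) v))"
proof -
  let ?a = "\<lambda>m. 1 / (qpoch q cq m * qpoch q (qpow q (\<mu> - lam)) m)"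
  let ?y = "\<lambda>m. (arg_y q lam M ^^ m) v"
  let ?t = "\<lambda>m. ?a m *\<^sub>C series_term (Eq_coeff q) (arg_f q lam M) (int m + N) (?y m)"
  let ?f = "\<lambda>(m, n). if int n = int m + N then ?t m else 0"
  \<comment> \<open>On the line n = m + N with m < B, every n lies below \<open>?R\<close>.\<close>
  let ?R = "nat (int B + N)"
  have "(if int n = int m + N then ?a m *\<^sub>C Eq_coeff q n *\<^sub>C (arg_f q lam M ^^ n) (?y m) else 0)
      = (if int n = int m + N then ?t m else 0)" for m n
    by (simp add: series_term_int [of n])
  then have "gen_act M (Mq q lam) v (\<mu> - 2 * of_int N) = Sum_any ?f"
    unfolding gen_act_def Mq_component [OF v] weight_lattice_eq_iff by simp
  also have "\<dots> = (\<Sum>(m, n)\<in>{..<B} \<times> {..<?R}. if int n = int m + N then ?t m else 0)"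
  proof (rule Sum_any.expand_superset)
    show "{mn. ?f mn \<noteq> 0} \<subseteq> {..<B} \<times> {..<?R}"
      using B by (auto simp: series_term_zero [OF clinear_arg_f] not_le [symmetric] split: if_splits)
  qed simp
  also have "\<dots> = (\<Sum>m<B. \<Sum>n<?R. if int n = int m + N then ?t m else 0)"
    by (simp add: sum.cartesian_product)
  also have "\<dots> = (\<Sum>m<B. ?t m)"
  proof (rule sum.cong [OF refl])
    fix m assume m: "m \<in> {..<B}"
    show "(\<Sum>n<?R. if int n = int m + N then ?t m else 0) = ?t m"
    proof (cases "int m + N < 0")
      case True
      then show ?thesis by (auto simp: series_term_def intro!: sum.neutral)
    next
      case False
      then have "int n = int m + N \<longleftrightarrow> n = nat (int m + N)" for n by auto
      then show ?thesis using m False by simp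
    qed
  qed
  finally show ?thesis .
qed

lemma Aq_act_eq:
  assumes v: "v \<in> weight_space M \<mu>" and B: "\<And>m. m \<ge> B \<Longrightarrow> (arg_y q lam M ^^ m) v = 0"
  shows "Aq_act q M (arg_x q lam) (arg_y q lam M) v =
    (\<Sum>m<B. (1 / (qpoch q cq m * qpoch q (qpow q (\<mu> - lam)) m)) *\<^sub>C (arg_y q lam M ^^ m) v)"
proof -
  have "Aq_act q M (arg_x q lam) (arg_y q lam M) v =
    Sum_any (\<lambda>m. (1 / (qpoch q cq m * qpoch q (qpow q (\<mu> - lam)) m)) *\<^sub>C (arg_y q lam M ^^ m) v)"
    unfolding Aq_act_def fun_h_weight [OF v] clinearD [OF clinear_funpow [OF clinear_arg_y]]
    by (simp add: arg_x_def)
  also have "\<dots> = (\<Sum>m<B. (1 / (qpoch q cq m * qpoch q (qpow q (\<mu> - lam)) m)) *\<^sub>C (arg_y q lam M ^^ m) v)"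
    using B by (intro Sum_any.expand_superset) (auto simp: not_le [symmetric])
  finally show ?thesis .
qed

text \<open>In one weight both sides are the same finite double sum over m and n; the right side has
  the sum over m inside, under the powers of \<open>arg_f\<close>.\<close>

lemma Mq_factorization:
  assumes v: "v \<in> weight_space M \<mu>" and B: "\<And>m. m \<ge> B \<Longrightarrow> (arg_y q lam M ^^ m) v = 0"
  shows "gen_act M (Mq q lam) v =
    fps_act M (Eq_series q) (arg_f q lam M) (Aq_act q M (arg_x q lam) (arg_y q lam M) v)"
proof
  fix \<kappa>
  let ?a = "\<lambda>m. 1 / (qpoch q cq m * qpoch q (qpow q (\<mu> - lam)) m)"
  let ?t = "\<lambda>m n. ?a m *\<^sub>C Eq_coeff q n *\<^sub>C (arg_f q lam M ^^ n) ((arg_y q lam M ^^ m) v)"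
  note Aq = Aq_act_eq [OF assms]
  have proj_sum: "weight_proj M \<kappa> (Eq_coeff q n *\<^sub>C (arg_f q lam M ^^ n) (Aq_act q M (arg_x q lam)
      (arg_y q lam M) v))
    = (\<Sum>m<B. weight_proj M \<kappa> (?t m n))" for n
    by (simp add: Aq clinearD [OF clinear_funpow [OF clinear_arg_f]] cvec.scale_sum_right
        clinearD [OF clinear_weight_proj] mult.commute)
  have "weight_proj M \<kappa> (?t m n) = (if \<kappa> = \<mu> + 2 * of_nat m - 2 * of_nat n then ?t m n else 0)" for m n
    by (intro weight_proj_homogeneous weight_scale arg_f_funpow_weight arg_y_funpow_weight v)
  then have eq: "fps_act M (Eq_series q) (arg_f q lam M) (Aq_act q M (arg_x q lam) (arg_y q lam M) v) \<kappa>
    = Sum_any (\<lambda>n. \<Sum>m<B. if \<kappa> = \<mu> + 2 * of_nat m - 2 * of_nat n then ?t m n else 0)"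
    by (simp only: fps_act_def proj_sum flip: Eq_coeff_def)
  show "gen_act M (Mq q lam) v \<kappa> =
    fps_act M (Eq_series q) (arg_f q lam M) (Aq_act q M (arg_x q lam) (arg_y q lam M) v) \<kappa>"
    unfolding eq
  proof (cases "\<exists>N. \<kappa> = \<mu> - 2 * of_int N")
    case False
    have "\<kappa> \<noteq> \<mu> + 2 * of_nat m - 2 * of_nat n" for m n
    proof
      assume "\<kappa> = \<mu> + 2 * of_nat m - 2 * of_nat n"
      then have "\<kappa> = \<mu> - 2 * of_int (int n - int m)" by simp
      then show False using False by blast
    qed
    then show "gen_act M (Mq q lam) v \<kappa> =
        Sum_any (\<lambda>n. \<Sum>m<B. if \<kappa> = \<mu> + 2 * of_nat m - 2 * of_nat n then ?t m n else 0)"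
      using gen_act_Mq_off [OF v] False by simp
  next
    case True
    then obtain N where N: "\<kappa> = \<mu> - 2 * of_int N" by blast
    let ?R = "nat (int B + N)"
    have "Sum_any (\<lambda>n. \<Sum>m<B. if int n = int m + N then ?t m n else 0)
      = (\<Sum>n<?R. \<Sum>m<B. if int n = int m + N then ?t m n else 0)"
    proof (rule Sum_any.expand_superset)
      show "{n. (\<Sum>m<B. if int n = int m + N then ?t m n else 0) \<noteq> 0} \<subseteq> {..<?R}"
      proof
        fix n assume "n \<in> {n. (\<Sum>m<B. if int n = int m + N then ?t m n else 0) \<noteq> 0}"
        then obtain m where "m \<in> {..<B}" "(if int n = int m + N then ?t m n else 0) \<noteq> 0"
          by (auto elim: sum.not_neutral_contains_not_neutral)
        then show "n \<in> {..<?R}" by (auto split: if_splits)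
      qed
    qed simp
    also have "\<dots> = (\<Sum>m<B. \<Sum>n<?R. if int n = int m + N then ?t m n else 0)"
      by (rule sum.swap)
    also have "\<dots> = (\<Sum>m<B. ?a m *\<^sub>C
        series_term (Eq_coeff q) (arg_f q lam M) (int m + N) ((arg_y q lam M ^^ m) v))"
    proof (rule sum.cong [OF refl])
      fix m assume m: "m \<in> {..<B}"
      show "(\<Sum>n<?R. if int n = int m + N then ?t m n else 0) = ?a m *\<^sub>C
        series_term (Eq_coeff q) (arg_f q lam M) (int m + N) ((arg_y q lam M ^^ m) v)"
      proof (cases "int m + N < 0")
        case True
        then show ?thesis by (auto simp: series_term_def intro!: sum.neutral)
      next
        case False
        then have "int n = int m + N \<longleftrightarrow> n = nat (int m + N)" for n by auto
        then show ?thesis using m False by (simp add: series_term_def)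
      qed
    qed
    finally show "gen_act M (Mq q lam) v \<kappa> =
        Sum_any (\<lambda>n. \<Sum>m<B. if \<kappa> = \<mu> + 2 * of_nat m - 2 * of_nat n then ?t m n else 0)"
      by (simp only: N gen_act_Mq [OF assms] weight_lattice_eq_iff)
  qed
qed

lemma arg_x_arg_y: "fun_h M (arg_x q lam) (arg_y q lam M v) =
    cq\<^sup>2 *\<^sub>C arg_y q lam M (fun_h M (arg_x q lam) v)"
proof (rule clinear_eqI [of "\<lambda>v. fun_h M (arg_x q lam) (arg_y q lam M v)"])
  fix \<nu> v
  assume v: "v \<in> weight_space M \<nu>"
  show "fun_h M (arg_x q lam) (arg_y q lam M v) =
      cq\<^sup>2 *\<^sub>C arg_y q lam M (fun_h M (arg_x q lam) v)"
    by (simp add: fun_h_weight [OF v] fun_h_weight [OF arg_y_weight [OF v]] arg_x_def cq_power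
        clinearD [OF clinear_arg_y] algebra_simps flip: qpow_add)
qed (rule clinear_compose [OF clinear_fun_h clinear_arg_y]
    clinear_scaled [OF clinear_compose [OF clinear_arg_y clinear_fun_h]])+

end

section \<open>The fusion identity\<close>

text \<open>A q-binomial theorem with divided powers: \<open>k\<close> is an abstract q-integer and
  \<open>c\<close> the reciprocal of its factorial. It covers both coproducts: \<open>arg_f\<close>
  with r = 1/q and c = \<open>Eq_coeff q\<close>, and \<open>arg_y\<close> with r = q and c n =
  1/(q;q)_n.\<close>

lemma tensor_q_binomial:
  fixes D :: "('w::complex_vector, 'v::complex_vector) tensor \<Rightarrow> ('w, 'v) tensor"
  assumes lin: "clinear D"
    and D: "\<And>a b. D (s a \<otimes>\<^sub>t t b) = r ^ b *\<^sub>C (s (Suc a) \<otimes>\<^sub>t t b) + s a \<otimes>\<^sub>t t (Suc b)"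
    and k: "\<And>a b. k (a + b) = r ^ b * k a + k b"
    and k_nonzero: "\<And>n. k (Suc n) \<noteq> 0"
    and c: "\<And>n. c n = k (Suc n) * c (Suc n)" and c0: "c 0 = 1"
  shows "c n *\<^sub>C (D ^^ n) (s 0 \<otimes>\<^sub>t t 0) = (\<Sum>b\<le>n. (c (n - b) * c b) *\<^sub>C (s (n - b) \<otimes>\<^sub>t t b))"
proof (induction n)
  case (Suc n)
  \<comment> \<open>This lets both sums run over all b up to n + 1: the added terms, b = n + 1 in
    the first and b = 0 in the second, vanish.\<close>
  have k0: "k 0 = 0" using k [of 0 0] by simp
  let ?p = "\<lambda>b. s (Suc n - b) \<otimes>\<^sub>t t b"
  have "k (Suc n) *\<^sub>C c (Suc n) *\<^sub>C (D ^^ Suc n) (s 0 \<otimes>\<^sub>t t 0)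
      = D (c n *\<^sub>C (D ^^ n) (s 0 \<otimes>\<^sub>t t 0))"
    by (simp add: clinearD [OF lin] c [of n])
  also have "\<dots> = (\<Sum>b\<le>n. (r ^ b * c (n - b) * c b) *\<^sub>C (s (Suc (n - b)) \<otimes>\<^sub>t t b))
      + (\<Sum>b\<le>n. (c (n - b) * c b) *\<^sub>C (s (n - b) \<otimes>\<^sub>t t (Suc b)))"
    unfolding Suc.IH clinearD [OF lin] D
    by (simp add: cvec.scale_right_distrib sum.distrib mult_ac)
  also have "(\<Sum>b\<le>n. (r ^ b * c (n - b) * c b) *\<^sub>C (s (Suc (n - b)) \<otimes>\<^sub>t t b))
      = (\<Sum>b\<le>n. (r ^ b * k (Suc n - b) * c (Suc n - b) * c b) *\<^sub>C ?p b)"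
    by (intro sum.cong refl) (simp add: c [of "n - _"] Suc_diff_le mult_ac)
  also have "\<dots> = (\<Sum>b\<le>Suc n. (r ^ b * k (Suc n - b) * c (Suc n - b) * c b) *\<^sub>C ?p b)"
    by (simp add: k0)
  also have "(\<Sum>b\<le>n. (c (n - b) * c b) *\<^sub>C (s (n - b) \<otimes>\<^sub>t t (Suc b)))
      = (\<Sum>b\<le>Suc n. (c (Suc n - b) * (k b * c b)) *\<^sub>C ?p b)"
    unfolding sum.atMost_Suc_shift by (simp add: k0 c [symmetric])
  also have "(\<Sum>b\<le>Suc n. (r ^ b * k (Suc n - b) * c (Suc n - b) * c b) *\<^sub>C ?p b) + \<dots>
      = (\<Sum>b\<le>Suc n. (k (Suc n) * (c (Suc n - b) * c b)) *\<^sub>C ?p b)"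
    unfolding sum.distrib [symmetric]
  proof (intro sum.cong refl)
    fix b assume "b \<in> {..Suc n}"
    then have "k (Suc n) = r ^ b * k (Suc n - b) + k b" using k [of "Suc n - b" b] by simp
    then show "(r ^ b * k (Suc n - b) * c (Suc n - b) * c b) *\<^sub>C ?p b + (c (Suc n - b) * (k b * c b))
        *\<^sub>C ?p b
        = (k (Suc n) * (c (Suc n - b) * c b)) *\<^sub>C ?p b"
      by (simp add: ring_distribs mult_ac flip: cvec.scale_left_distrib)
  qed
  also have "\<dots> = k (Suc n) *\<^sub>C (\<Sum>b\<le>Suc n. (c (Suc n - b) * c b) *\<^sub>C ?p b)"
    unfolding cvec.scale_sum_right by simp
  finally show ?case using k_nonzero by (simp only: cvec.scale_cancel_left) simp
qed (simp add: c0)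

text \<open>The coefficient of each \<open>Z l\<close> is collected: \<open>A l\<close> directly,
  and the value of \<open>B\<close> at l - 1 from the shifted term.\<close>

lemma sum_shift_combine:
  fixes Z :: "nat \<Rightarrow> 'a::complex_vector"
  assumes "A (Suc J) = 0" "C 0 = A 0" "\<And>l. l \<le> J \<Longrightarrow> C (Suc l) = A (Suc l) + B l"
  shows "(\<Sum>l\<le>J. A l *\<^sub>C Z l + B l *\<^sub>C Z (Suc l)) = (\<Sum>l\<le>Suc J. C l *\<^sub>C Z l)"
proof -
  have "(\<Sum>l\<le>J. A l *\<^sub>C Z l) = (\<Sum>l\<le>Suc J. A l *\<^sub>C Z l)" by (simp add: assms(1))
  also have "\<dots> = A 0 *\<^sub>C Z 0 + (\<Sum>l\<le>J. A (Suc l) *\<^sub>C Z (Suc l))" by (rule sum.atMost_Suc_shift)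
  finally have "(\<Sum>l\<le>J. A l *\<^sub>C Z l + B l *\<^sub>C Z (Suc l)) =
      A 0 *\<^sub>C Z 0 + (\<Sum>l\<le>J. (A (Suc l) + B l) *\<^sub>C Z (Suc l))"
    by (simp add: sum.distrib cvec.scale_left_distrib add.assoc)
  also have "\<dots> = (\<Sum>l\<le>Suc J. C l *\<^sub>C Z l)"
    unfolding sum.atMost_Suc_shift using assms by simp
  finally show ?thesis .
qed

section \<open>The coefficient recurrence and the word identity in the first factor\<close>

context q_base
begin

text \<open>The factor 1 + q^J X is written to the right of the series, where X meets the word acted
  upon. That X uses up one degree, hence the index k - 1.\<close>

lemma series_term_q_shift:
  assumes "clinear X"
  shows "series_term (\<lambda>n. Eq_coeff q n * cq ^ (n * J)) X k t =
    series_term (\<lambda>n. Eq_coeff q n * cq ^ (n * Suc J)) X k t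
    + cq ^ J *\<^sub>C series_term (\<lambda>n. Eq_coeff q n * cq ^ (n * Suc J)) X (k - 1) (X t)"
proof -
  \<comment> \<open>For k = 0 the second term has index -1 and is zero by convention; positive k is
    the case of \<open>Eq_coeff_Suc\<close>.\<close>
  consider "k < 0" | "k = 0" | n where "k = int (Suc n)"
    by (metis linorder_cases zero_less_imp_eq_int gr0_implies_Suc of_nat_0_less_iff)
  then show ?thesis
  proof cases
    case 3
    have e: "Eq_coeff q n = Eq_coeff q (Suc n) * (1 - cq ^ Suc n) / cq ^ n"
      using Eq_coeff_Suc [of n] by simp
    have "Eq_coeff q (Suc n) * cq ^ (Suc n * J) = Eq_coeff q (Suc n) * cq ^ (Suc n * Suc J)
        + cq ^ J * (Eq_coeff q n * cq ^ (n * Suc J))"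
      unfolding e by (simp add: power_add field_simps)
    then show ?thesis
      unfolding 3 by (simp add: series_term_def funpow_swap1 nat_add_distrib flip: cvec.scale_left_distrib)
  qed (auto simp: series_term_def)
qed

text \<open>Total coefficient of the word P^i X^l in the first factor that accompanies y^J v. The
  l-th term of \<open>Jq\<close> contributes \<open>Eq_coeff q l\<close> / (z;q)_l; the power i + j
  of the coproduct of y, with j = J - l, gives the rest, where q^(il) arises because P acts next to
  a vector of weight \<nu> + 2l. The value 0 for l > J makes the recurrence valid at the
  boundary.\<close>

definition fusion_coeff :: "complex \<Rightarrow> complex \<Rightarrow> nat \<Rightarrow> nat \<Rightarrow> nat \<Rightarrow> complex" where
  "fusion_coeff z u J i l = (if l \<le> J then Eq_coeff q l * cq ^ (i * l) /
     (qpoch q cq i * qpoch q cq (J - l) * qpoch q u (i + (J - l)) * qpoch q z l) else 0)"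

text \<open>Scalar of the lower word when X passes P^(i+1) on X^l w: X^l lowers the weight by 2l,
  hence u / q^(2l).\<close>

definition lower_coeff :: "complex \<Rightarrow> complex \<Rightarrow> nat \<Rightarrow> nat \<Rightarrow> complex" where
  "lower_coeff z u i l = (1 - cq ^ Suc i) * (z - cq ^ i * (u / cq ^ (2 * l)))"

lemma one_minus_cq_power: "1 - cq ^ Suc n \<noteq> 0"
  using cq_power_neq_1 [of "Suc n"] by simp

text \<open>With a = J - l, both terms are put over (u;q)_(i+a+1). The contributions of u to the
  numerator cancel, and 1 - q^(a+2l) z remains.\<close>

lemma fusion_coeff_diff:
  assumes u: "\<And>n. qpoch q u n \<noteq> 0"
  shows "fusion_coeff z u (l + a) i l - cq ^ (l + a) * lower_coeff z u i l * fusion_coeff z u (l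
      + a) (Suc i) l
    = Eq_coeff q l * cq ^ (i * l) * (1 - cq ^ (a + 2 * l) * z)
      / (qpoch q cq i * qpoch q cq a * qpoch q u (Suc (i + a)) * qpoch q z l)"
proof -
  have "1 - u * cq ^ (i + a) \<noteq> 0" using u [of "Suc (i + a)"] by (simp add: qpoch_Suc)
  then have 1: "fusion_coeff z u (l + a) i l = Eq_coeff q l * cq ^ (i * l) * (1 - u * cq ^ (i + a))
      / (qpoch q cq i * qpoch q cq a * qpoch q u (Suc (i + a)) * qpoch q z l)"
    by (simp add: fusion_coeff_def qpoch_Suc)
  have "1 - cq * cq ^ i \<noteq> 0" using one_minus_cq_power [of i] by simp
  then have 2: "lower_coeff z u i l * fusion_coeff z u (l + a) (Suc i) l =
      Eq_coeff q l * cq ^ (i * l) * (cq ^ l * (z - cq ^ i * (u / cq ^ (2 * l))))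
      / (qpoch q cq i * qpoch q cq a * qpoch q u (Suc (i + a)) * qpoch q z l)"
    by (simp add: fusion_coeff_def lower_coeff_def qpoch_Suc power_add mult_ac)
  have "1 - u * cq ^ (i + a) - cq ^ (l + a) * (cq ^ l * (z - cq ^ i * (u / cq ^ (2 * l))))
      = 1 - cq ^ (a + 2 * l) * z"
    by (simp add: power_add mult_2 mult_2_right field_simps)
  moreover have "c * x / d - p * (c * y / d) = c * (x - p * y) / d" for c d p x y :: complex
    by (simp add: right_diff_distrib diff_divide_distrib mult_ac)
  ultimately show ?thesis
    by (simp only: mult.assoc [of "cq ^ (l + a)"] 1 2)
qed

lemma fusion_coeff_0:
  assumes u: "\<And>n. qpoch q u n \<noteq> 0"
  shows "(1 - cq ^ Suc J) * (1 - z * cq ^ J) * fusion_coeff z u (Suc J) i 0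
    = fusion_coeff z u J i 0 - cq ^ J * lower_coeff z u i 0 * fusion_coeff z u J (Suc i) 0"
  using fusion_coeff_diff [OF u, of z 0 J i] one_minus_cq_power [of J]
  by (simp add: fusion_coeff_def qpoch_Suc mult_ac)

text \<open>The right side collects the word itself, the commutator term and the word with one X
  fewer. For J = l + 1 + a, removing the common factor leaves (1 - q^(J+1)) (1 - z q^J) = (1 -
  q^(a+1)) (1 - q^(a+2l+2) z) + q^(a+1) (1 - q^(l+1)) (1 - z q^l).\<close>

lemma fusion_coeff_Suc:
  assumes u: "\<And>n. qpoch q u n \<noteq> 0" and z: "\<And>n. qpoch q z n \<noteq> 0" and "l \<le> J"
  shows "(1 - cq ^ Suc J) * (1 - z * cq ^ J) * fusion_coeff z u (Suc J) i (Suc l)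
    = fusion_coeff z u J i (Suc l) - cq ^ J * lower_coeff z u i (Suc l) * fusion_coeff z u J (Suc i) (Suc l)
      + cq ^ (J + i) * fusion_coeff z u J i l"
proof -
  have z': "1 - z * cq ^ n \<noteq> 0" for n using z [of "Suc n"] by (simp add: qpoch_Suc)
  have e: "Eq_coeff q l = Eq_coeff q (Suc l) * (1 - cq ^ Suc l) / cq ^ l"
    using Eq_coeff_Suc [of l] by simp
  show ?thesis
  proof (cases "l = J")
    \<comment> \<open>At l = J the coefficients for J with last index J + 1 vanish by definition,
      and only the contribution of l remains.\<close>
    case True
    show ?thesis unfolding True
      using z' [of J] e [unfolded True]
      by (simp add: fusion_coeff_def qpoch_Suc power_add mult_ac)
  next
    case False
    then obtain a where J: "J = Suc l + a" using assms(3) le_Suc_ex [of "Suc l" J] by auto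
    have 1: "fusion_coeff z u J i l = Eq_coeff q (Suc l) * cq ^ (i * Suc l) * ((1 - cq ^ Suc l) * (1
        - z * cq ^ l) / cq ^ (i + l))
      / (qpoch q cq i * qpoch q cq (Suc a) * qpoch q u (Suc (i + a)) * qpoch q z (Suc l))"
      using z' [of l] unfolding J by (simp add: fusion_coeff_def e power_add qpoch_Suc [of q z] mult_ac)
    have 2: "fusion_coeff z u J i (Suc l) - cq ^ J * lower_coeff z u i (Suc l) * fusion_coeff z u J
        (Suc i) (Suc l)
      = Eq_coeff q (Suc l) * cq ^ (i * Suc l) * ((1 - cq ^ Suc a) * (1 - cq ^ (a + 2 * Suc l) * z))
      / (qpoch q cq i * qpoch q cq (Suc a) * qpoch q u (Suc (i + a)) * qpoch q z (Suc l))"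
      unfolding J fusion_coeff_diff [OF u] qpoch_Suc [of q cq a]
      using one_minus_cq_power [of a] by (simp add: mult_ac)
    have 3: "fusion_coeff z u (Suc J) i (Suc l) = Eq_coeff q (Suc l) * cq ^ (i * Suc l)
      / (qpoch q cq i * qpoch q cq (Suc a) * qpoch q u (Suc (i + a)) * qpoch q z (Suc l))"
      unfolding J by (simp add: fusion_coeff_def)
    have "(1 - cq ^ Suc J) * (1 - z * cq ^ J) = (1 - cq ^ Suc a) * (1 - cq ^ (a + 2 * Suc l) * z)
      + cq ^ (J + i) * ((1 - cq ^ Suc l) * (1 - z * cq ^ l) / cq ^ (i + l))"
      unfolding J by (simp add: power_add mult_2 mult_2_right field_simps)
    then show ?thesis
      unfolding 1 2 3 by (simp only: times_divide_eq_right add_divide_distrib [symmetric])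
        (simp add: algebra_simps)
  qed
qed

text \<open>This is \<open>E\<^sub>q(q\<^sup>J X) = (1 + q\<^sup>J X) E\<^sub>q(q\<^bsup>J+1\<^esup> X)\<close> applied inside the sum on the left.\<close>

lemma fusion_sum_step:
  fixes X P :: "'a::complex_vector \<Rightarrow> 'a"
  assumes lin: "clinear X"
    and comm: "\<And>i l. X ((P ^^ Suc i) ((X ^^ l) w)) =
      cq ^ Suc i *\<^sub>C (P ^^ Suc i) ((X ^^ Suc l) w) - lower_coeff z u i l *\<^sub>C (P ^^ i) ((X ^^ l) w)"
    and u: "\<And>n. qpoch q u n \<noteq> 0" and z: "\<And>n. qpoch q z n \<noteq> 0"
    and B: "\<And>l. l \<le> Suc J \<Longrightarrow> (P ^^ B) ((X ^^ l) w) = 0"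
  shows "(\<Sum>l\<le>J. \<Sum>i<B. fusion_coeff z u J i l *\<^sub>C
      series_term (\<lambda>n. Eq_coeff q n * cq ^ (n * J)) X (K + int i - int l) ((P ^^ i) ((X ^^ l) w)))
    = ((1 - cq ^ Suc J) * (1 - z * cq ^ J)) *\<^sub>C
      (\<Sum>l\<le>Suc J. \<Sum>i<B. fusion_coeff z u (Suc J) i l *\<^sub>C
      series_term (\<lambda>n. Eq_coeff q n * cq ^ (n * Suc J)) X (K + int i - int l) ((P ^^ i) ((X ^^ l) w)))"
proof -
  let ?S = "series_term (\<lambda>n. Eq_coeff q n * cq ^ (n * J)) X"
  let ?T = "series_term (\<lambda>n. Eq_coeff q n * cq ^ (n * Suc J)) X"
  let ?t = "\<lambda>i l. (P ^^ i) ((X ^^ l) w)"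
  let ?Z = "\<lambda>i l. ?T (K + int i - int l) (?t i l)"
  let ?s = "fusion_coeff z u J"
  let ?A = "\<lambda>i l. ?s i l - cq ^ J * lower_coeff z u i l * ?s (Suc i) l"
  let ?B = "\<lambda>i l. cq ^ (J + i) * ?s i l"
  note linT = clinearD [OF clinear_series_term [OF lin]]
  \<comment> \<open>Terms with i = B vanish. The sums can thus be lengthened by one term, which
    gives room for the shift from i + 1 to i caused by the commutator.\<close>
  have Z0: "?Z B l = 0" if "l \<le> Suc J" for l
    using B [OF that] by (simp add: linT)
  \<comment> \<open>For i = 0 there is no P to pass and hence no lower word.\<close>
  have S0: "?S (K + int 0 - int l) (?t 0 l) = ?Z 0 l + cq ^ (J + 0) *\<^sub>C ?Z 0 (Suc l)" for l
    unfolding series_term_q_shift [OF lin, of J] by (simp add: algebra_simps)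
  have SSuc: "?S (K + int (Suc i) - int l) (?t (Suc i) l)
      = ?Z (Suc i) l + cq ^ (J + Suc i) *\<^sub>C ?Z (Suc i) (Suc l)
      - (cq ^ J * lower_coeff z u i l) *\<^sub>C ?Z i l" for i l
  proof -
    \<comment> \<open>Moving X through P^(i+1) keeps the weight, so both resulting words carry
      exactly the index of their \<open>?Z\<close>.\<close>
    have [simp]: "K + int (Suc i) - int l - 1 = K + int i - int l" "K + int (Suc i) - int (Suc l)
        = K + int i - int l"
      by simp_all
    show ?thesis
      unfolding series_term_q_shift [OF lin, of J] comm linT
      by (simp only: cvec.scale_right_diff_distrib scaleC_scaleC power_add mult.assoc) (simp add:
          algebra_simps)
  qed
  have "(\<Sum>i<B. ?s i l *\<^sub>C ?S (K + int i - int l) (?t i l))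
      = (\<Sum>i<B. ?A i l *\<^sub>C ?Z i l + ?B i l *\<^sub>C ?Z i (Suc l))" if l: "l \<le> J" for l
  proof -
    have "(\<Sum>i<B. ?s i l *\<^sub>C ?S (K + int i - int l) (?t i l))
        = (\<Sum>i<Suc B. ?s i l *\<^sub>C ?S (K + int i - int l) (?t i l))"
      using B [of l] l by (simp add: linT)
    also have "\<dots> = ?s 0 l *\<^sub>C (?Z 0 l + cq ^ (J + 0) *\<^sub>C ?Z 0 (Suc l)) + (\<Sum>i<B. ?s (Suc i) l
        *\<^sub>C (?Z (Suc i) l + cq ^ (J + Suc i) *\<^sub>C ?Z (Suc i) (Suc l)
      - (cq ^ J * lower_coeff z u i l) *\<^sub>C ?Z i l))"
      unfolding sum.lessThan_Suc_shift S0 SSuc ..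
    also have "\<dots> = (\<Sum>i<Suc B. ?s i l *\<^sub>C ?Z i l + ?B i l *\<^sub>C ?Z i (Suc l))
        - (\<Sum>i<B. (cq ^ J * lower_coeff z u i l * ?s (Suc i) l) *\<^sub>C ?Z i l)"
      unfolding sum.lessThan_Suc_shift [of _ B] add_diff_eq [symmetric] sum_subtractf [symmetric]
      by (simp only: cvec.scale_right_distrib cvec.scale_right_diff_distrib scaleC_scaleC mult_ac
          add_diff_eq)
    also have "\<dots> = (\<Sum>i<B. ?s i l *\<^sub>C ?Z i l + ?B i l *\<^sub>C ?Z i (Suc l))
        - (\<Sum>i<B. (cq ^ J * lower_coeff z u i l * ?s (Suc i) l) *\<^sub>C ?Z i l)"
      using Z0 [of l] Z0 [of "Suc l"] l by simp
    also have "\<dots> = (\<Sum>i<B. ?A i l *\<^sub>C ?Z i l + ?B i l *\<^sub>C ?Z i (Suc l))"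
      unfolding sum_subtractf [symmetric] by (simp add: cvec.scale_left_diff_distrib algebra_simps)
    finally show ?thesis .
  qed
  then have "(\<Sum>l\<le>J. \<Sum>i<B. ?s i l *\<^sub>C ?S (K + int i - int l) (?t i l))
      = (\<Sum>l\<le>J. \<Sum>i<B. ?A i l *\<^sub>C ?Z i l + ?B i l *\<^sub>C ?Z i (Suc l))"
    by simp
  also have "\<dots> = (\<Sum>i<B. \<Sum>l\<le>J. ?A i l *\<^sub>C ?Z i l + ?B i l *\<^sub>C ?Z i (Suc l))"
    by (rule sum.swap)
  also have "\<dots> = (\<Sum>i<B. \<Sum>l\<le>Suc J. ((1 - cq ^ Suc J) * (1 - z * cq ^ J) * fusion_coeff z u (Suc J) i l)
      *\<^sub>C ?Z i l)"
  proof (rule sum.cong [OF refl], rule sum_shift_combine)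
    show "?A i (Suc J) = 0" for i by (simp add: fusion_coeff_def)
  qed (simp_all only: fusion_coeff_0 [OF u] fusion_coeff_Suc [OF u z])
  also have "\<dots> = (\<Sum>l\<le>Suc J. \<Sum>i<B. ((1 - cq ^ Suc J) * (1 - z * cq ^ J) * fusion_coeff z u (Suc J) i l)
      *\<^sub>C ?Z i l)"
    by (rule sum.swap)
  finally show ?thesis
    by (simp only: cvec.scale_sum_right scaleC_scaleC)
qed

text \<open>The two sides are the first-factor coefficients of y^J v on the two sides of the fusion
  identity. At J = 0 they coincide, and each step contributes the factor by which (q;q)_J (z;q)_J
  grows.\<close>

lemma fusion_sum:
  fixes X P :: "'a::complex_vector \<Rightarrow> 'a"
  assumes lin: "clinear X"
    and comm: "\<And>i l. X ((P ^^ Suc i) ((X ^^ l) w)) =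
      cq ^ Suc i *\<^sub>C (P ^^ Suc i) ((X ^^ Suc l) w) - lower_coeff z u i l *\<^sub>C (P ^^ i) ((X ^^ l) w)"
    and u: "\<And>n. qpoch q u n \<noteq> 0" and z: "\<And>n. qpoch q z n \<noteq> 0"
    and B: "\<And>l. l \<le> J \<Longrightarrow> (P ^^ B) ((X ^^ l) w) = 0"
  shows "(\<Sum>l\<le>J. \<Sum>i<B. fusion_coeff z u J i l *\<^sub>C
      series_term (\<lambda>n. Eq_coeff q n * cq ^ (n * J)) X (K + int i - int l) ((P ^^ i) ((X ^^ l) w)))
    = (1 / (qpoch q cq J * qpoch q z J)) *\<^sub>C
      (\<Sum>i<B. (1 / (qpoch q cq i * qpoch q u i)) *\<^sub>C series_term (Eq_coeff q) X (K + int i) ((P ^^ i) w))"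
  using B
proof (induction J)
  case 0
  show ?case by (simp add: fusion_coeff_def)
next
  case (Suc J)
  let ?d = "(1 - cq ^ Suc J) * (1 - z * cq ^ J)"
  have d: "?d \<noteq> 0"
    using one_minus_cq_power [of J] z [of "Suc J"] by (simp add: qpoch_Suc)
  have q: "qpoch q cq (Suc J) * qpoch q z (Suc J) = ?d * (qpoch q cq J * qpoch q z J)"
    by (simp add: qpoch_Suc)
  have "(1 / (qpoch q cq J * qpoch q z J)) *\<^sub>C x = ?d
      *\<^sub>C (1 / (qpoch q cq (Suc J) * qpoch q z (Suc J))) *\<^sub>C x" for x :: 'a
    unfolding q using d by simp
  with fusion_sum_step [OF lin comm u z Suc.prems, where K = K] Suc.IH [OF Suc.prems]
  have "?d *\<^sub>C (\<Sum>l\<le>Suc J. \<Sum>i<B. fusion_coeff z u (Suc J) i l *\<^sub>C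
      series_term (\<lambda>n. Eq_coeff q n * cq ^ (n * Suc J)) X (K + int i - int l) ((P ^^ i) ((X ^^ l) w)))
    = ?d *\<^sub>C (1 / (qpoch q cq (Suc J) * qpoch q z (Suc J))) *\<^sub>C
      (\<Sum>i<B. (1 / (qpoch q cq i * qpoch q u i)) *\<^sub>C series_term (Eq_coeff q) X (K + int i) ((P ^^ i) w))"
    by simp
  then show ?case
    unfolding cvec.scale_cancel_left using d by blast
qed

end

section \<open>Moving \<open>arg_f\<close> past powers of \<open>arg_y\<close>; uniform
  nilpotency\<close>

locale q_module = q_base q for q +
  fixes M :: "'v::complex_vector uq_ops"
  assumes module: "uq_module q M"

sublocale q_module \<subseteq> q_graded q M
  using uq_module_graded [OF module] by (intro q_graded.intro q_base_axioms)

context q_module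
begin

text \<open>The scalars at FE and EF differ by a factor q, so the q-commutator reduces to the
  commutator of e and f, a q-number. One factor of (1 - q)^2 cancels its denominator.\<close>

lemma arg_f_arg_y:
  assumes v: "v \<in> weight_space M \<mu>"
  shows "arg_f q lam M (arg_y q lam M v) = cq *\<^sub>C arg_y q lam M (arg_f q lam M v)
    - ((1 - cq) * (qpow q (- lam) - qpow q (\<mu> - lam))) *\<^sub>C v"
proof -
  let ?k = "(1 - cq)\<^sup>2 * qpow q (- 1 / 2 - lam + \<mu> / 2)"
  have comm: "F M (E M v) = E M (F M v) - qnum q \<mu> *\<^sub>C v"
  proof -
    have "\<forall>\<nu>. \<forall>v\<in>weight_space M \<nu>. E M (F M v) - F M (E M v) = qnum q \<nu> *\<^sub>C v"
      using module unfolding uq_module_def by (elim conjE)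
    then have "qnum q \<mu> *\<^sub>C v = E M (F M v) - F M (E M v)" using v by simp
    then show ?thesis by simp
  qed
  have "arg_f q lam M (arg_y q lam M v)
      = ((1 - cq)\<^sup>2 * (qpow q (- 5 / 4 - lam / 2 + \<mu> / 4) * qpow q (1 / 4 - lam / 2 + (\<mu> + 2) / 4)))
          *\<^sub>C F M (E M v)"
    by (simp add: arg_y_weight_eq [OF v] arg_f_weight_eq [OF E_weight [OF v]] clinearD [OF clinear_arg_f]
        clinearD [OF linear_F] mult_ac)
  also have "qpow q (- 5 / 4 - lam / 2 + \<mu> / 4) * qpow q (1 / 4 - lam / 2 + (\<mu> + 2) / 4)
      = qpow q (- 1 / 2 - lam + \<mu> / 2)"
    unfolding qpow_add [symmetric] by (rule arg_cong [of _ _ "qpow q"]) (simp add: field_simps)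
  finally have 1: "arg_f q lam M (arg_y q lam M v) = ?k *\<^sub>C F M (E M v)" .
  have "cq *\<^sub>C arg_y q lam M (arg_f q lam M v) =
      ((1 - cq)\<^sup>2 * (qpow q 1 * qpow q (1 / 4 - lam / 2 + \<mu> / 4) * qpow q (- 5 / 4 - lam / 2 + (\<mu>
          - 2) / 4))) *\<^sub>C E M (F M v)"
    using cq_power [of 1]
    by (simp add: arg_f_weight_eq [OF v] arg_y_weight_eq [OF F_weight [OF v]] clinearD [OF clinear_arg_y]
        clinearD [OF linear_E] mult_ac)
  also have "qpow q 1 * qpow q (1 / 4 - lam / 2 + \<mu> / 4) * qpow q (- 5 / 4 - lam / 2 + (\<mu> - 2) / 4)
      = qpow q (- 1 / 2 - lam + \<mu> / 2)"
    unfolding qpow_add [symmetric] by (rule arg_cong [of _ _ "qpow q"]) (simp add: field_simps)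
  finally have 2: "cq *\<^sub>C arg_y q lam M (arg_f q lam M v) = ?k *\<^sub>C E M (F M v)" .
  have "?k * qnum q \<mu> = (1 - cq) * ((qpow q (- 1 / 2 - lam + \<mu> / 2) * qpow q ((1 - \<mu>) / 2)) * (1
      - qpow q \<mu>))"
    by (simp add: qnum_eq power2_eq_square)
  also have "qpow q (- 1 / 2 - lam + \<mu> / 2) * qpow q ((1 - \<mu>) / 2) = qpow q (- lam)"
    unfolding qpow_add [symmetric] by (rule arg_cong [of _ _ "qpow q"]) (simp add: field_simps)
  also have "qpow q (- lam) * (1 - qpow q \<mu>) = qpow q (- lam) - qpow q (\<mu> - lam)"
    by (simp add: right_diff_distrib flip: qpow_add)
  finally show ?thesis
    unfolding 1 2 comm cvec.scale_right_diff_distrib scaleC_scaleC by simp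
qed

text \<open>The innermost \<open>arg_y\<close> is split off; it raises the weight by 2 and so
  multiplies u = q^(\<mu> - lam) by q^2. With z = q^(-lam) the scalars combine by q^(i+1) (1 - q) (z
  - u) + (1 - q^(i+1)) (z - q^(i+2) u) = (1 - q^(i+2)) (z - q^(i+1) u).\<close>

lemma arg_f_arg_y_funpow:
  assumes "v \<in> weight_space M \<mu>"
  shows "arg_f q lam M ((arg_y q lam M ^^ Suc i) v) =
    cq ^ Suc i *\<^sub>C (arg_y q lam M ^^ Suc i) (arg_f q lam M v)
    - ((1 - cq ^ Suc i) * (qpow q (- lam) - cq ^ i * qpow q (\<mu> - lam))) *\<^sub>C (arg_y q lam M ^^ i) v"
  using assms
proof (induction i arbitrary: v \<mu>)
  case 0
  then show ?case by (simp add: arg_f_arg_y)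
next
  case (Suc i)
  let ?X = "arg_f q lam M" and ?P = "arg_y q lam M" and ?z = "qpow q (- lam)" and ?u = "qpow q (\<mu> - lam)"
  note lin = clinearD [OF clinear_funpow [OF clinear_arg_y]]
  have u: "qpow q (\<mu> + 2 - lam) = cq ^ 2 * ?u"
    by (simp only: cq_power flip: qpow_add) (simp add: algebra_simps)
  have pow: "(?P ^^ Suc i) (?P x) = (?P ^^ Suc (Suc i)) x" for x
    by (simp add: funpow_swap1)
  have "?X ((?P ^^ Suc (Suc i)) v) = ?X ((?P ^^ Suc i) (?P v))"
    by (simp add: funpow_swap1)
  also have "\<dots> = cq ^ Suc i *\<^sub>C (?P ^^ Suc i) (?X (?P v))
      - ((1 - cq ^ Suc i) * (?z - cq ^ i * (cq ^ 2 * ?u))) *\<^sub>C (?P ^^ Suc i) v"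
    using Suc.IH [OF arg_y_weight [OF Suc.prems]] unfolding u by (simp add: funpow_swap1)
  also have "cq ^ Suc i *\<^sub>C (?P ^^ Suc i) (?X (?P v)) = cq ^ Suc (Suc i) *\<^sub>C (?P ^^ Suc (Suc i)) (?X v)
      - (cq ^ Suc i * ((1 - cq) * (?z - ?u))) *\<^sub>C (?P ^^ Suc i) v"
    unfolding arg_f_arg_y [OF Suc.prems] lin pow
    by (simp only: cvec.scale_right_diff_distrib scaleC_scaleC power_Suc2 mult.assoc)
  also have "\<dots> - ((1 - cq ^ Suc i) * (?z - cq ^ i * (cq ^ 2 * ?u))) *\<^sub>C (?P ^^ Suc i) v
      = cq ^ Suc (Suc i) *\<^sub>C (?P ^^ Suc (Suc i)) (?X v)
      - (cq ^ Suc i * ((1 - cq) * (?z - ?u)) + (1 - cq ^ Suc i) * (?z - cq ^ i * (cq ^ 2 * ?u)))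
          *\<^sub>C (?P ^^ Suc i) v"
    by (simp only: cvec.scale_left_distrib diff_diff_eq)
  also have "cq ^ Suc i * ((1 - cq) * (?z - ?u)) + (1 - cq ^ Suc i) * (?z - cq ^ i * (cq ^ 2 * ?u))
      = (1 - cq ^ Suc (Suc i)) * (?z - cq ^ Suc i * ?u)"
    by (simp add: algebra_simps power2_eq_square)
  finally show ?case .
qed

lemma arg_f_lower:
  assumes "v \<in> weight_space M \<mu>"
  shows "arg_f q lam M ((arg_y q lam M ^^ Suc i) ((arg_f q lam M ^^ l) v)) =
    cq ^ Suc i *\<^sub>C (arg_y q lam M ^^ Suc i) ((arg_f q lam M ^^ Suc l) v)
    - lower_coeff (qpow q (- lam)) (qpow q (\<mu> - lam)) i l *\<^sub>C (arg_y q lam M ^^ i) ((arg_f q lam M ^^ l) v)"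
proof -
  have "\<mu> - 2 * of_nat l - lam = \<mu> - lam - of_nat (2 * l)" by simp
  then have "qpow q (\<mu> - 2 * of_nat l - lam) = qpow q (\<mu> - lam) / cq ^ (2 * l)"
    by (simp only: cq_power qpow_diff)
  then show ?thesis
    using arg_f_arg_y_funpow [OF arg_f_funpow_weight [OF assms], of lam i l lam]
    by (simp add: lower_coeff_def)
qed

text \<open>One bound must serve all weights \<mu> - 2l with l up to \<open>L\<close>, because
  \<open>fusion_sum\<close> applies powers of P to every X^l w. Starting 2l lower costs l more
  applications.\<close>

lemma arg_y_nilpotent:
  obtains B where "\<And>l m v. l \<le> L \<Longrightarrow> m \<ge> B \<Longrightarrow> v \<in> weight_space M (\<mu> - 2 * of_nat l)
      \<Longrightarrow> (arg_y q lam M ^^ m) v = 0"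
proof -
  obtain N where N: "\<And>m s. m \<ge> N \<Longrightarrow> s \<in> weight_space M (\<mu> + 2 * of_nat m) \<Longrightarrow> s = 0"
    using weight_space_eventually_zero [OF module] by blast
  have "(arg_y q lam M ^^ m) v = 0"
    if "l \<le> L" "m \<ge> N + L" "v \<in> weight_space M (\<mu> - 2 * of_nat l)" for l m v
  proof (rule N)
    show "m - l \<ge> N" using that by simp
    have "\<mu> - 2 * of_nat l + 2 * of_nat m = \<mu> + 2 * of_nat (m - l)"
      using that by (simp add: of_nat_diff algebra_simps)
    then show "(arg_y q lam M ^^ m) v \<in> weight_space M (\<mu> + 2 * of_nat (m - l))"
      using arg_y_funpow_weight [OF that(3), of m lam] by (simp only:)
  qed
  then show thesis by (rule that)
qed

end

lemma funpow_scaled: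
  fixes g :: "'a::complex_vector \<Rightarrow> 'a"
  assumes "clinear g" "\<And>x. f x = c *\<^sub>C g x"
  shows "(f ^^ n) x = c ^ n *\<^sub>C (g ^^ n) x"
  by (induction n) (simp_all add: assms(2) clinearD [OF assms(1)])

section \<open>Coproducts of powers of \<open>arg_f\<close> and \<open>arg_y\<close>, and the fusion
  matrix\<close>

locale q_module_pair = W: q_module q W + V: q_module q V
  for q :: real and W :: "'w::complex_vector uq_ops" and V :: "'v::complex_vector uq_ops"

sublocale q_module_pair \<subseteq> graded_pair W V ..

sublocale q_module_pair \<subseteq> T: q_graded q "uq_tensor q W V"
  by (intro q_graded.intro W.q_base_axioms graded_tensor)

context q_module_pair
begin

abbreviation (input) cq :: complex where "cq \<equiv> complex_of_real q"

text \<open>Changing the weight of the other tensor factor only rescales the operator; in the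
  coproduct this plays the role of q-commutation of the two summands.\<close>

lemma arg_f_shift: "arg_f q (lam - \<beta>) W v = qpow q (\<beta> / 2) *\<^sub>C arg_f q lam W v"
  by (simp add: arg_f_def algebra_simps diff_divide_distrib flip: qpow_add)

lemma arg_y_shift: "arg_y q (lam - \<beta>) W v = qpow q (\<beta> / 2) *\<^sub>C arg_y q lam W v"
proof -
  have "qpow q (- 5 / 4 - (lam - \<beta>) / 2) = qpow q (\<beta> / 2) * qpow q (- 5 / 4 - lam / 2)"
    by (simp add: diff_divide_distrib algebra_simps flip: qpow_add)
  then show ?thesis by (simp add: arg_y_def mult_ac)
qed

text \<open>In the first summand q^(\<beta>/4) occurs twice, from the coproduct and from q^(h/4) on
  the total weight, which moves the parameter to lam - \<beta>. In the second summand the coproduct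
  cancels \<alpha>.\<close>

lemma arg_f_tensor:
  assumes "s \<in> weight_space W \<alpha>" "t \<in> weight_space V \<beta>"
  shows "arg_f q lam (uq_tensor q W V) (s \<otimes>\<^sub>t t) = arg_f q (lam - \<beta>) W s \<otimes>\<^sub>t t + s \<otimes>\<^sub>t arg_f q lam V t"
proof -
  have "qpow q (1 / 4 - lam / 2 + (\<alpha> + \<beta>) / 4) * qpow q (\<beta> / 4) = qpow q (1 / 4 - (lam - \<beta>) / 2 + \<alpha> / 4)"
    and "qpow q (1 / 4 - lam / 2 + (\<alpha> + \<beta>) / 4) * qpow q (- \<alpha> / 4) = qpow q (1 / 4 - lam / 2 + \<beta> / 4)"
    unfolding qpow_add [symmetric] by (rule arg_cong [of _ _ "qpow q"], simp add: field_simps)+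
  then show ?thesis
    unfolding T.arg_f_weight_eq [OF weight_tens [OF assms]] tensor_ops(2) [OF assms]
      W.arg_f_weight_eq [OF assms(1)] V.arg_f_weight_eq [OF assms(2)] tens_linear
      cvec.scale_right_distrib scaleC_scaleC
    by (simp only:)
qed

lemma arg_y_tensor:
  assumes "s \<in> weight_space W \<alpha>" "t \<in> weight_space V \<beta>"
  shows "arg_y q lam (uq_tensor q W V) (s \<otimes>\<^sub>t t) = arg_y q (lam - \<beta>) W s \<otimes>\<^sub>t t + s \<otimes>\<^sub>t arg_y q lam V t"
proof -
  have "qpow q (- 5 / 4 - lam / 2 + (\<alpha> + \<beta>) / 4) * qpow q (\<beta> / 4)
      = qpow q (- 5 / 4 - (lam - \<beta>) / 2 + \<alpha> / 4)"
    and "qpow q (- 5 / 4 - lam / 2 + (\<alpha> + \<beta>) / 4) * qpow q (- \<alpha> / 4) = qpow q (- 5 / 4 - lam / 2 + \<beta> / 4)"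
    unfolding qpow_add [symmetric] by (rule arg_cong [of _ _ "qpow q"], simp add: field_simps)+
  then show ?thesis
    unfolding T.arg_y_weight_eq [OF weight_tens [OF assms]] tensor_ops(1) [OF assms]
      W.arg_y_weight_eq [OF assms(1)] V.arg_y_weight_eq [OF assms(2)] tens_linear
      cvec.scale_right_distrib scaleC_scaleC
    by (simp only: mult.assoc)
qed

lemma arg_f_tensor_funpow:
  assumes s: "s \<in> weight_space W \<alpha>" and t: "t \<in> weight_space V \<beta>"
  shows "Eq_coeff q n *\<^sub>C (arg_f q lam (uq_tensor q W V) ^^ n) (s \<otimes>\<^sub>t t) =
    (\<Sum>b\<le>n. (Eq_coeff q (n - b) * Eq_coeff q b) *\<^sub>C
      ((arg_f q (lam - \<beta>) W ^^ (n - b)) s \<otimes>\<^sub>t (arg_f q lam V ^^ b) t))"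
proof -
  let ?X = "arg_f q (lam - \<beta>) W" and ?Y = "arg_f q lam V"
  have "arg_f q lam (uq_tensor q W V) ((?X ^^ a) s \<otimes>\<^sub>t (?Y ^^ b) t) =
      inverse cq ^ b *\<^sub>C ((?X ^^ Suc a) s \<otimes>\<^sub>t (?Y ^^ b) t) + (?X ^^ a) s \<otimes>\<^sub>t (?Y ^^ Suc b) t" for a b
  proof -
    \<comment> \<open>Y^b lowers the weight of t by 2b, which multiplies X by q^(-b); hence r =
      1/q.\<close>
    have "arg_f q (lam - (\<beta> - 2 * of_nat b)) W x = inverse cq ^ b *\<^sub>C ?X x" for x
      using arg_f_shift [of "lam - \<beta>" "- 2 * of_nat b" x]
      by (simp add: W.cq_power power_inverse qpow_minus algebra_simps)
    then show ?thesis
      unfolding arg_f_tensor [OF W.arg_f_funpow_weight [OF s] V.arg_f_funpow_weight [OF t]]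
      by (simp add: tens_linear)
  qed
  \<comment> \<open>The q-integer is the quotient of two successive values of
    \<open>Eq_coeff\<close>; its leading factor q makes the first one 1 - q.\<close>
  moreover have k: "cq * (inverse cq ^ Suc n - 1) = (1 - cq ^ Suc n) / cq ^ n" for n
    by (simp add: field_simps)
  have "Eq_coeff q n = cq * (inverse cq ^ Suc n - 1) * Eq_coeff q (Suc n)" for n
    unfolding k using W.Eq_coeff_Suc [of n] by (simp add: field_simps)
  moreover have "cq * (inverse cq ^ Suc n - 1) \<noteq> 0" for n
    unfolding k using W.one_minus_cq_power [of n] by simp
  moreover have "cq * (inverse cq ^ (a + b) - 1) =
      inverse cq ^ b * (cq * (inverse cq ^ a - 1)) + cq * (inverse cq ^ b - 1)" for a b
    by (simp add: power_add algebra_simps)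
  ultimately have "Eq_coeff q n *\<^sub>C (arg_f q lam (uq_tensor q W V) ^^ n) ((?X ^^ 0) s \<otimes>\<^sub>t (?Y ^^ 0) t) =
    (\<Sum>b\<le>n. (Eq_coeff q (n - b) * Eq_coeff q b) *\<^sub>C ((?X ^^ (n - b)) s \<otimes>\<^sub>t (?Y ^^ b) t))"
    by (intro tensor_q_binomial [OF T.clinear_arg_f, where k = "\<lambda>n. cq * (inverse cq ^ n - 1)"
          and s = "\<lambda>a. (?X ^^ a) s" and t = "\<lambda>b. (?Y ^^ b) t" and r
              = "inverse cq"]) (rule Eq_coeff_0 | assumption)+
  then show ?thesis by simp
qed

lemma arg_y_tensor_funpow:
  assumes s: "s \<in> weight_space W \<alpha>" and t: "t \<in> weight_space V \<beta>"
  shows "(1 / qpoch q cq n) *\<^sub>C (arg_y q lam (uq_tensor q W V) ^^ n) (s \<otimes>\<^sub>t t) =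
    (\<Sum>b\<le>n. (1 / qpoch q cq (n - b) * (1 / qpoch q cq b)) *\<^sub>C
      ((arg_y q (lam - \<beta>) W ^^ (n - b)) s \<otimes>\<^sub>t (arg_y q lam V ^^ b) t))"
proof -
  let ?X = "arg_y q (lam - \<beta>) W" and ?Y = "arg_y q lam V"
  have "arg_y q lam (uq_tensor q W V) ((?X ^^ a) s \<otimes>\<^sub>t (?Y ^^ b) t) =
      cq ^ b *\<^sub>C ((?X ^^ Suc a) s \<otimes>\<^sub>t (?Y ^^ b) t) + (?X ^^ a) s \<otimes>\<^sub>t (?Y ^^ Suc b) t" for a b
  proof -
    have "arg_y q (lam - (\<beta> + 2 * of_nat b)) W x = cq ^ b *\<^sub>C ?X x" for x
      using arg_y_shift [of "lam - \<beta>" "2 * of_nat b" x]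
      by (simp add: W.cq_power diff_diff_eq)
    then show ?thesis
      unfolding arg_y_tensor [OF W.arg_y_funpow_weight [OF s] V.arg_y_funpow_weight [OF t]]
      by (simp add: tens_linear)
  qed
  moreover have "1 / qpoch q cq n = (1 - cq ^ Suc n) * (1 / qpoch q cq (Suc n))" for n
    using W.one_minus_cq_power [of n] by (simp add: qpoch_Suc)
  moreover have "1 - cq ^ (a + b) = cq ^ b * (1 - cq ^ a) + (1 - cq ^ b)" for a b
    by (simp add: power_add algebra_simps)
  moreover have "1 / qpoch q cq 0 = 1" by simp
  ultimately have "(1 / qpoch q cq n) *\<^sub>C (arg_y q lam (uq_tensor q W V) ^^ n) ((?X ^^ 0) s
      \<otimes>\<^sub>t (?Y ^^ 0) t) =
    (\<Sum>b\<le>n. (1 / qpoch q cq (n - b) * (1 / qpoch q cq b)) *\<^sub>C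
      ((?X ^^ (n - b)) s \<otimes>\<^sub>t (?Y ^^ b) t))"
    by (intro tensor_q_binomial [OF T.clinear_arg_y, where k = "\<lambda>n. 1 - cq ^ n" and c
        = "\<lambda>n. 1 / qpoch q cq n"
          and s = "\<lambda>a. (?X ^^ a) s" and t = "\<lambda>b. (?Y ^^ b) t" and r
              = cq]) (rule W.one_minus_cq_power | assumption)+
  then show ?thesis by simp
qed

text \<open>On homogeneous vectors every summand is a scalar multiple of one tensor, so only scalars
  are compared. The exponents balance for the parameter lam - \<nu> in the first operator, the value
  that the coproduct produces as well.\<close>

lemma Jq_eq:
  assumes w: "w \<in> weight_space W \<mu>" and v: "v \<in> weight_space V \<nu>"
    and L: "\<And>l. l \<ge> L \<Longrightarrow> (arg_y q lam V ^^ l) v = 0"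
  shows "Jq q lam W V (w \<otimes>\<^sub>t v) = (\<Sum>l<L. (Eq_coeff q l / qpoch q (qpow q (\<nu> - lam)) l) *\<^sub>C
      ((arg_f q (lam - \<nu>) W ^^ l) w \<otimes>\<^sub>t (arg_y q lam V ^^ l) v))"
proof -
  let ?c = "\<lambda>l. Eq_coeff q l / qpoch q (qpow q (\<nu> - lam)) l"
  have term_eq: "(qpow q (- (of_nat l / 2) * (lam + 1)) / qfact q l) *\<^sub>C
       tensor_map
         ((F W ^^ l) \<circ> fun_h W (\<lambda>h. qpow q (of_nat l * h / 4)))
         ((E V ^^ l) \<circ> fun_h V (\<lambda>h. qpow q (of_nat l * h / 4) / qnum_poch q (- lam + h) l))
         (w \<otimes>\<^sub>t v) = ?c l *\<^sub>C ((arg_f q (lam - \<nu>) W ^^ l) w \<otimes>\<^sub>t (arg_y q lam V ^^ l) v)" for l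
  proof -
    let ?A = "qpow q (- (of_nat l / 2) * (lam + 1))" and ?M = "qpow q (of_nat l * \<mu> / 4)"
      and ?N = "qpow q (of_nat l * \<nu> / 4)"
      and ?n = "qpow q (- (of_nat l * (of_nat l - 1) / 4))"
      and ?p = "qpow q (of_nat l * (1 - (- lam + \<nu>)) / 2 - of_nat l * (of_nat l - 1) / 4)"
      and ?e = "qpow q (of_nat l * (of_nat l - 1) / 2)"
      and ?f = "qpow q (of_nat l * (1 / 4 - (lam - \<nu>) / 2 + \<mu> / 4) - of_nat l * (of_nat l - 1) / 4)"
      and ?y = "qpow q (of_nat l * (- 5 / 4 - lam / 2 + \<nu> / 4) + of_nat l * (of_nat l - 1) / 4)"
      and ?ql = "qpoch q cq l" and ?z = "qpoch q (qpow q (- lam + \<nu>)) l"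
    have key: "?A * ?M * ?N = ?e * ?f * ?y * (?n * ?p)"
      unfolding qpow_add [symmetric]
      by (rule arg_cong [of _ _ "qpow q"]) (simp add: field_simps)
    have "?A / qfact q l * (?M * (?N / qnum_poch q (- lam + \<nu>) l))
        = ?A * ?M * ?N * (1 - cq) ^ (2 * l) / (?n * ?p * (?ql * ?z))"
      using W.q_less by (simp add: W.qfact_eq W.qnum_poch_eq mult_2 mult_2_right power_add mult_ac)
    also have "\<dots> = ?e * ?f * ?y * (1 - cq) ^ (2 * l) / (?ql * ?z)"
      unfolding key by (simp add: mult_ac)
    also have "\<dots> = ?c l * (?f * ((1 - cq) ^ (2 * l) * ?y))"
      by (simp add: Eq_coeff_def Eq_series_def mult_ac)
    finally have "(?A / qfact q l * (?M * (?N / qnum_poch q (- lam + \<nu>) l))) *\<^sub>C ((F W ^^ l) w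
        \<otimes>\<^sub>t (E V ^^ l) v)
      = (?c l * (?f * ((1 - cq) ^ (2 * l) * ?y))) *\<^sub>C ((F W ^^ l) w \<otimes>\<^sub>t (E V ^^ l) v)" by simp
    moreover have "clinear ((F W ^^ l) \<circ> fun_h W (\<lambda>h. qpow q (of_nat l * h / 4)))"
      "clinear ((E V ^^ l) \<circ> fun_h V (\<lambda>h. qpow q (of_nat l * h / 4) / qnum_poch q (- lam + h) l))"
      unfolding comp_def
      by (rule clinear_compose [OF clinear_funpow [OF W.linear_F] W.clinear_fun_h]
          clinear_compose [OF clinear_funpow [OF V.linear_E] V.clinear_fun_h])+
    ultimately show ?thesis
      unfolding W.arg_f_funpow [OF w] V.arg_y_funpow [OF v]
      by (simp only: tensor_map_tens comp_apply W.fun_h_weight [OF w] V.fun_h_weight [OF v]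
          tens_linear scaleC_scaleC
          clinearD [OF clinear_funpow [OF W.linear_F]] clinearD [OF clinear_funpow [OF V.linear_E]])
        (simp only: mult_ac)
  qed
  show ?thesis
    unfolding Jq_def term_eq
    using L by (intro Sum_any.expand_superset) (auto simp: tens_linear not_le [symmetric])
qed

end

text \<open>Both regions contain all indices of nonzero terms. It serves to pass from m = i + j to
  separate i and j, and from separate j and l to J = j + l.\<close>

lemma sum_triangle:
  fixes g :: "nat \<Rightarrow> nat \<Rightarrow> 'a::comm_monoid_add"
  assumes "\<And>i j. i \<ge> A \<Longrightarrow> i + j < n \<Longrightarrow> g i j = 0" "\<And>i j. j \<ge> C \<Longrightarrow> i + j < n \<Longrightarrow> g i j = 0"
    and "\<And>i j. i < A \<Longrightarrow> j < C \<Longrightarrow> n \<le> i + j \<Longrightarrow> g i j = 0"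
  shows "(\<Sum>k<n. \<Sum>i\<le>k. g i (k - i)) = (\<Sum>i<A. \<Sum>j<C. g i j)"
proof -
  have fin: "finite {(i, j). i + j < n}"
    by (rule finite_subset [of _ "{..<n} \<times> {..<n}"]) auto
  have "(\<Sum>k<n. \<Sum>i\<le>k. g i (k - i)) = (\<Sum>(i, j) \<in> {(i, j). i + j < n}. g i j)"
    by (rule sum.triangle_reindex [symmetric])
  also have "\<dots> = (\<Sum>(i, j) \<in> {..<A} \<times> {..<C}. g i j)"
  proof (rule sum.mono_neutral_cong [OF _ fin])
    fix p assume "p \<in> {..<A} \<times> {..<C} - {(i, j). i + j < n}"
    then show "(case p of (i, j) \<Rightarrow> g i j) = 0" using assms(3) by (auto simp: not_less)
  next
    fix p assume "p \<in> {(i, j). i + j < n} - {..<A} \<times> {..<C}"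
    then obtain i j where "p = (i, j)" "i + j < n" "A \<le> i \<or> C \<le> j"
      by (cases p) (auto simp: not_less)
    then show "(case p of (i, j) \<Rightarrow> g i j) = 0" using assms(1,2) by auto
  qed auto
  finally show ?thesis by (simp add: sum.cartesian_product)
qed

section \<open>Comparison of the weight components of both sides\<close>

context q_module_pair
begin

lemma Jq_weight:
  assumes w: "w \<in> weight_space W \<mu>" and v: "v \<in> weight_space V \<nu>"
    and L: "\<And>l. l \<ge> L \<Longrightarrow> (arg_y q lam V ^^ l) v = 0"
  shows "Jq q lam W V (w \<otimes>\<^sub>t v) \<in> weight_space (uq_tensor q W V) (\<mu> + \<nu>)"
proof -
  have "(arg_f q (lam - \<nu>) W ^^ l) w \<otimes>\<^sub>t (arg_y q lam V ^^ l) v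
      \<in> weight_space (uq_tensor q W V) (\<mu> + \<nu>)" for l
    using weight_tens [OF W.arg_f_funpow_weight [OF w] V.arg_y_funpow_weight [OF v], of l _ l lam q]
    by (simp add: algebra_simps)
  moreover have "Jq q lam W V (w \<otimes>\<^sub>t v) = (\<Sum>l<L. (Eq_coeff q l / qpoch q (qpow q (\<nu> - lam)) l) *\<^sub>C
      ((arg_f q (lam - \<nu>) W ^^ l) w \<otimes>\<^sub>t (arg_y q lam V ^^ l) v))"
    using w v L by (rule Jq_eq)
  ultimately show ?thesis
    by (simp only:) (intro T.weight_sum T.weight_scale)
qed

text \<open>A single bound \<open>R\<close> works for all indices k below it: for b > k the series
  in the first factor has a negative index and vanishes.\<close>

lemma series_term_tensor:
  assumes s: "s \<in> weight_space W \<alpha>" and t: "t \<in> weight_space V \<beta>" and R: "k < int R"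
  shows "series_term (Eq_coeff q) (arg_f q lam (uq_tensor q W V)) k (s \<otimes>\<^sub>t t) =
    (\<Sum>b<R. Eq_coeff q b *\<^sub>C
      (series_term (Eq_coeff q) (arg_f q (lam - \<beta>) W) (k - int b) s \<otimes>\<^sub>t (arg_f q lam V ^^ b) t))"
proof (cases "k < 0")
  case True
  then show ?thesis by (simp add: series_term_def tens_linear)
next
  case False
  then obtain n where k: "k = int n" by (metis nonneg_int_cases not_less)
  have "series_term (Eq_coeff q) (arg_f q (lam - \<beta>) W) (k - int b) s =
      Eq_coeff q (n - b) *\<^sub>C (arg_f q (lam - \<beta>) W ^^ (n - b)) s" if "b \<le> n" for b
    by (rule series_term_int) (use that k in simp)
  then have "series_term (Eq_coeff q) (arg_f q lam (uq_tensor q W V)) k (s \<otimes>\<^sub>t t) =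
      (\<Sum>b\<le>n. Eq_coeff q b *\<^sub>C
      (series_term (Eq_coeff q) (arg_f q (lam - \<beta>) W) (k - int b) s \<otimes>\<^sub>t (arg_f q lam V ^^ b) t))"
    unfolding series_term_int [OF k [symmetric]] arg_f_tensor_funpow [OF s t]
    by (intro sum.cong refl) (simp add: tens_linear mult.commute)
  also have "\<dots> = (\<Sum>b<R. Eq_coeff q b *\<^sub>C
      (series_term (Eq_coeff q) (arg_f q (lam - \<beta>) W) (k - int b) s \<otimes>\<^sub>t (arg_f q lam V ^^ b) t))"
    using R k by (intro sum.mono_neutral_left) (auto simp: series_term_def tens_linear)
  finally show ?thesis .
qed

text \<open>After y^J the second vector has weight \<nu> + 2J; this is the origin of q^J in E_q(q^J
  X).\<close>

lemma series_term_weight_shift: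
  "series_term (Eq_coeff q) (arg_f q (lam - (\<nu> + 2 * of_nat J)) W) k s =
    series_term (\<lambda>n. Eq_coeff q n * cq ^ (n * J)) (arg_f q (lam - \<nu>) W) k s"
proof -
  have "arg_f q (lam - (\<nu> + 2 * of_nat J)) W x = cq ^ J *\<^sub>C arg_f q (lam - \<nu>) W x" for x
    using arg_f_shift [of "lam - \<nu>" "2 * of_nat J" x] by (simp add: W.cq_power diff_diff_eq)
  from funpow_scaled [OF W.clinear_arg_f this] show ?thesis
    by (simp add: series_term_def power_mult [symmetric] mult.commute)
qed

lemma arg_y_funpow_weight_shift:
  "(arg_y q (lam - (\<nu> + 2 * of_nat l)) W ^^ i) s = cq ^ (i * l) *\<^sub>C (arg_y q (lam - \<nu>) W ^^ i) s"
proof -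
  have "arg_y q (lam - (\<nu> + 2 * of_nat l)) W x = cq ^ l *\<^sub>C arg_y q (lam - \<nu>) W x" for x
    using arg_y_shift [of "lam - \<nu>" "2 * of_nat l" x] by (simp add: W.cq_power diff_diff_eq)
  from funpow_scaled [OF W.clinear_arg_y this] show ?thesis
    by (simp add: power_mult [symmetric] mult.commute)
qed

text \<open>Three expansions meet: l from \<open>Jq\<close>, m = i + j from the power of the
  coproduct of y, and b from the series in the coproduct of f. Grouping by J = j + l isolates the
  coefficient of G^b Y^J v, to which \<open>fusion_sum\<close> applies with K = N + J - b.\<close>

lemma fusion_left_component:
  fixes lam \<mu> \<nu> :: complex
  defines "X \<equiv> arg_f q (lam - \<nu>) W" and "P \<equiv> arg_y q (lam - \<nu>) W"
    and "G \<equiv> arg_f q lam V" and "Y \<equiv> arg_y q lam V"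
    and "z \<equiv> qpow q (\<nu> - lam)" and "u \<equiv> qpow q (\<mu> + \<nu> - lam)"
  assumes w: "w \<in> weight_space W \<mu>" and v: "v \<in> weight_space V \<nu>"
    and z0: "\<And>n. qpoch q z n \<noteq> 0" and u0: "\<And>n. qpoch q u n \<noteq> 0"
    and B: "\<And>l m. l \<le> L \<Longrightarrow> m \<ge> B \<Longrightarrow> (P ^^ m) ((X ^^ l) w) = 0"
    and L: "\<And>l. l \<ge> L \<Longrightarrow> (Y ^^ l) v = 0"
    and R: "N + int L + int B \<le> int R"
  shows "gen_act (uq_tensor q W V) (Mq q lam) (Jq q lam W V (w \<otimes>\<^sub>t v)) (\<mu> + \<nu> - 2 * of_int N) =
    (\<Sum>J<L. \<Sum>b<R. Eq_coeff q b *\<^sub>C (((1 / (qpoch q cq J * qpoch q z J)) *\<^sub>C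
      (\<Sum>i<B. (1 / (qpoch q cq i * qpoch q u i)) *\<^sub>C
        series_term (Eq_coeff q) X (N + int J - int b + int i) ((P ^^ i) w)))
      \<otimes>\<^sub>t (G ^^ b) ((Y ^^ J) v)))"
proof -
  let ?T = "uq_tensor q W V"
  let ?ST = "series_term (Eq_coeff q) (arg_f q lam ?T)"
  let ?YT = "arg_y q lam ?T"
  let ?p = "\<lambda>l. (X ^^ l) w \<otimes>\<^sub>t (Y ^^ l) v"
  let ?Jv = "\<Sum>l<L. (Eq_coeff q l / qpoch q z l) *\<^sub>C ?p l"
  let ?\<Phi> = "\<lambda>i j l. (Eq_coeff q l * cq ^ (i * l) / (qpoch q cq i * qpoch q cq j * qpoch q u (i
      + j) * qpoch q z l)) *\<^sub>C
    ?ST (int (i + j) + N) ((P ^^ i) ((X ^^ l) w) \<otimes>\<^sub>t (Y ^^ (j + l)) v)"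
  note linST = clinearD [OF clinear_series_term [OF T.clinear_arg_f]]
  note linYT = clinearD [OF clinear_funpow [OF T.clinear_arg_y]]
  have Xw: "(X ^^ l) w \<in> weight_space W (\<mu> - 2 * of_nat l)" for l
    unfolding X_def by (rule W.arg_f_funpow_weight [OF w])
  have Yv: "(Y ^^ l) v \<in> weight_space V (\<nu> + 2 * of_nat l)" for l
    unfolding Y_def by (rule V.arg_y_funpow_weight [OF v])
  have PXw: "(P ^^ i) ((X ^^ l) w) \<in> weight_space W (\<mu> - 2 * of_nat l + 2 * of_nat i)" for i l
    unfolding P_def by (rule W.arg_y_funpow_weight [OF Xw])
  have Jq: "Jq q lam W V (w \<otimes>\<^sub>t v) = ?Jv"
    using Jq_eq [OF w v, of L lam] L unfolding X_def Y_def z_def by blast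
  have Jw: "?Jv \<in> weight_space ?T (\<mu> + \<nu>)"
    unfolding Jq [symmetric] by (rule Jq_weight [OF w v]) (rule L [unfolded Y_def])
  have YT: "(1 / qpoch q cq m) *\<^sub>C (?YT ^^ m) (?p l) =
      (\<Sum>j\<le>m. (cq ^ ((m - j) * l) / (qpoch q cq (m - j) * qpoch q cq j)) *\<^sub>C
        ((P ^^ (m - j)) ((X ^^ l) w) \<otimes>\<^sub>t (Y ^^ (j + l)) v))" for m l
    unfolding arg_y_tensor_funpow [OF Xw Yv] unfolding arg_y_funpow_weight_shift P_def Y_def
    by (simp add: funpow_add tens_linear)
  \<comment> \<open>In each binomial term either j >= L and the second slot is zero, or m - j >= B
    and the first is.\<close>
  have "(?YT ^^ m) (?p l) = 0" if "m \<ge> B + L" "l < L" for m l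
  proof -
    have "(P ^^ (m - j)) ((X ^^ l) w) \<otimes>\<^sub>t (Y ^^ (j + l)) v = 0" for j
    proof (cases "j < L")
      case True
      then show ?thesis using B [of l "m - j"] that by (simp add: tens_linear)
    qed (use L [of "j + l"] in \<open>simp add: tens_linear\<close>)
    then have "(1 / qpoch q cq m) *\<^sub>C (?YT ^^ m) (?p l) = 0" unfolding YT by simp
    then show ?thesis by simp
  qed
  then have nil: "(?YT ^^ m) ?Jv = 0" if "m \<ge> B + L" for m
    using that by (simp add: linYT)
  have summand: "(1 / (qpoch q cq m * qpoch q (qpow q (\<mu> + \<nu> - lam)) m)) *\<^sub>C ?ST (int m
      + N) ((?YT ^^ m) ?Jv)
      = (\<Sum>l<L. \<Sum>j\<le>m. ?\<Phi> (m - j) j l)" for m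
  proof -
    have "(1 / (qpoch q cq m * qpoch q u m)) *\<^sub>C ?ST (int m + N) ((?YT ^^ m) ?Jv)
        = (\<Sum>l<L. (Eq_coeff q l / (qpoch q z l * qpoch q u m)) *\<^sub>C
            ?ST (int m + N) ((1 / qpoch q cq m) *\<^sub>C (?YT ^^ m) (?p l)))"
      by (simp add: linYT linST cvec.scale_sum_right mult_ac)
    also have "\<dots> = (\<Sum>l<L. \<Sum>j\<le>m. ?\<Phi> (m - j) j l)"
      unfolding YT linST cvec.scale_sum_right by (intro sum.cong refl) (simp add: mult_ac)
    finally show ?thesis unfolding u_def .
  qed
  have \<Phi>0: "?\<Phi> i j l = 0" if "l \<le> L" "i \<ge> B \<or> j + l \<ge> L" for i j l
    using that B [of l i] L [of "j + l"] by (auto simp: tens_linear linST)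
  have "gen_act ?T (Mq q lam) ?Jv (\<mu> + \<nu> - 2 * of_int N)
      = (\<Sum>m<B + L. (1 / (qpoch q cq m * qpoch q (qpow q (\<mu> + \<nu> - lam)) m)) *\<^sub>C
          ?ST (int m + N) ((?YT ^^ m) ?Jv))"
    by (rule T.gen_act_Mq [OF Jw]) (rule nil)
  then have "gen_act ?T (Mq q lam) (Jq q lam W V (w \<otimes>\<^sub>t v)) (\<mu> + \<nu> - 2 * of_int N)
      = (\<Sum>m<B + L. \<Sum>l<L. \<Sum>j\<le>m. ?\<Phi> (m - j) j l)"
    by (simp only: Jq summand)
  also have "\<dots> = (\<Sum>l<L. \<Sum>m<B + L. \<Sum>j\<le>m. ?\<Phi> (m - j) j l)"
    by (rule sum.swap)
  also have "\<dots> = (\<Sum>l<L. \<Sum>j<L. \<Sum>i<B. ?\<Phi> i j l)"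
    using \<Phi>0 by (intro sum.cong refl sum_triangle) auto
  also have "\<dots> = (\<Sum>J<L. \<Sum>l\<le>J. \<Sum>i<B. ?\<Phi> i (J - l) l)"
    using \<Phi>0 by (intro sum_triangle [symmetric] sum.neutral ballI) auto
  also have "\<dots> = (\<Sum>J<L. \<Sum>b<R. Eq_coeff q b *\<^sub>C (((1 / (qpoch q cq J * qpoch q z J)) *\<^sub>C
      (\<Sum>i<B. (1 / (qpoch q cq i * qpoch q u i)) *\<^sub>C
        series_term (Eq_coeff q) X (N + int J - int b + int i) ((P ^^ i) w)))
      \<otimes>\<^sub>t (G ^^ b) ((Y ^^ J) v)))"
  proof (rule sum.cong [OF refl])
    fix J assume "J \<in> {..<L}"
    then have J: "J < L" by simp
    let ?S = "series_term (\<lambda>n. Eq_coeff q n * cq ^ (n * J)) X"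
    let ?t = "\<lambda>b. (G ^^ b) ((Y ^^ J) v)"
    have "?\<Phi> i (J - l) l = (\<Sum>b<R. Eq_coeff q b *\<^sub>C ((W.fusion_coeff z u J i l *\<^sub>C
        ?S (N + int J - int b + int i - int l) ((P ^^ i) ((X ^^ l) w))) \<otimes>\<^sub>t ?t b))"
      if "l \<le> J" "i < B" for i l
    proof -
      have "int (i + (J - l)) + N < int R" using that J R by simp
      from series_term_tensor [OF PXw [of i l] Yv [of J] this, of lam]
      have "?ST (int (i + (J - l)) + N) ((P ^^ i) ((X ^^ l) w) \<otimes>\<^sub>t (Y ^^ (J - l + l)) v) =
        (\<Sum>b<R. Eq_coeff q b *\<^sub>C
          (?S (N + int J - int b + int i - int l) ((P ^^ i) ((X ^^ l) w)) \<otimes>\<^sub>t ?t b))"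
        unfolding series_term_weight_shift X_def [symmetric] G_def [symmetric]
        using that by (simp add: of_nat_diff algebra_simps)
      then show ?thesis
        using that by (simp add: W.fusion_coeff_def cvec.scale_sum_right tens_linear mult_ac)
    qed
    then have "(\<Sum>l\<le>J. \<Sum>i<B. ?\<Phi> i (J - l) l) =
        (\<Sum>l\<le>J. \<Sum>i<B. \<Sum>b<R. Eq_coeff q b *\<^sub>C ((W.fusion_coeff z u J i l *\<^sub>C
        ?S (N + int J - int b + int i - int l) ((P ^^ i) ((X ^^ l) w))) \<otimes>\<^sub>t ?t b))"
      by simp
    also have "\<dots> = (\<Sum>b<R. \<Sum>l\<le>J. \<Sum>i<B. Eq_coeff q b *\<^sub>C ((W.fusion_coeff z u J i l *\<^sub>C
        ?S (N + int J - int b + int i - int l) ((P ^^ i) ((X ^^ l) w))) \<otimes>\<^sub>t ?t b))"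
      unfolding sum.swap [of _ "{..<R}" "{..<B}"] by (rule sum.swap)
    also have "\<dots> = (\<Sum>b<R. Eq_coeff q b *\<^sub>C ((\<Sum>l\<le>J. \<Sum>i<B. W.fusion_coeff z u J i l *\<^sub>C
        ?S (N + int J - int b + int i - int l) ((P ^^ i) ((X ^^ l) w))) \<otimes>\<^sub>t ?t b))"
      by (simp only: tens_linear cvec.scale_sum_right)
    also have "\<dots> = (\<Sum>b<R. Eq_coeff q b *\<^sub>C (((1 / (qpoch q cq J * qpoch q z J)) *\<^sub>C
      (\<Sum>i<B. (1 / (qpoch q cq i * qpoch q u i)) *\<^sub>C
        series_term (Eq_coeff q) X (N + int J - int b + int i) ((P ^^ i) w)))
      \<otimes>\<^sub>t ?t b))"
    proof -
      \<comment> \<open>For the parameter lam - \<nu> the constants in \<open>arg_f_lower\<close>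
        become z and u.\<close>
      have "qpow q (- (lam - \<nu>)) = z" "qpow q (\<mu> - (lam - \<nu>)) = u"
        by (simp_all add: z_def u_def algebra_simps)
      then have "X ((P ^^ Suc i) ((X ^^ l) w)) = cq ^ Suc i *\<^sub>C (P ^^ Suc i) ((X ^^ Suc l) w)
          - W.lower_coeff z u i l *\<^sub>C (P ^^ i) ((X ^^ l) w)" for i l
        using W.arg_f_lower [OF w, of "lam - \<nu>" i l] unfolding X_def P_def by simp
      moreover have "clinear X" unfolding X_def by (rule W.clinear_arg_f)
      ultimately show ?thesis
        using B J by (subst W.fusion_sum [OF _ _ u0 z0]) auto
    qed
    finally show "(\<Sum>l\<le>J. \<Sum>i<B. ?\<Phi> i (J - l) l) = \<dots>" .
  qed
  finally show ?thesis .
qed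

text \<open>The weight index N is split as K + (N - K). For fixed J the power of G is b = N + J - K,
  so the sum over K turns into a sum over b as in \<open>fusion_left_component\<close>.\<close>

lemma fusion_right_component:
  fixes lam \<mu> \<nu> :: complex
  defines "X \<equiv> arg_f q (lam - \<nu>) W" and "P \<equiv> arg_y q (lam - \<nu>) W"
    and "G \<equiv> arg_f q lam V" and "Y \<equiv> arg_y q lam V"
    and "z \<equiv> qpow q (\<nu> - lam)" and "u \<equiv> qpow q (\<mu> + \<nu> - lam)"
  assumes w: "w \<in> weight_space W \<mu>" and v: "v \<in> weight_space V \<nu>"
    and B: "\<And>m. m \<ge> B \<Longrightarrow> (P ^^ m) w = 0"
    and L: "\<And>l. l \<ge> L \<Longrightarrow> (Y ^^ l) v = 0"
    and R: "N + int L + int B \<le> int R"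
  shows "prod_tens (gen_act W (Mq q (lam - \<nu>)) w) (gen_act V (Mq q lam) v) (\<mu> + \<nu> - 2 * of_int N) =
    (\<Sum>J<L. \<Sum>b<R. Eq_coeff q b *\<^sub>C (((1 / (qpoch q cq J * qpoch q z J)) *\<^sub>C
      (\<Sum>i<B. (1 / (qpoch q cq i * qpoch q u i)) *\<^sub>C
        series_term (Eq_coeff q) X (N + int J - int b + int i) ((P ^^ i) w)))
      \<otimes>\<^sub>t (G ^^ b) ((Y ^^ J) v)))"
proof -
  let ?a = "\<lambda>K. \<Sum>i<B. (1 / (qpoch q cq i * qpoch q u i)) *\<^sub>C
        series_term (Eq_coeff q) X (int i + K) ((P ^^ i) w)"
  let ?c = "\<lambda>J. 1 / (qpoch q cq J * qpoch q z J)"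
  let ?b = "\<lambda>K. \<Sum>J<L. ?c J *\<^sub>C series_term (Eq_coeff q) G (int J + K) ((Y ^^ J) v)"
  let ?gW = "gen_act W (Mq q (lam - \<nu>)) w" and ?gV = "gen_act V (Mq q lam) v"
  \<comment> \<open>For K below -B the first component vanishes, for K above N + L the
    second.\<close>
  let ?A = "{- int B..N + int L}"
  have gW: "?gW (\<mu> - 2 * of_int K) = ?a K" for K
  proof -
    have "qpow q (\<mu> - (lam - \<nu>)) = u" by (simp add: u_def algebra_simps)
    then show ?thesis
      using W.gen_act_Mq [OF w, of B "lam - \<nu>" K] B
      unfolding X_def [symmetric] P_def [symmetric] by simp
  qed
  have gV: "?gV (\<nu> - 2 * of_int K) = ?b K" for K
    using V.gen_act_Mq [OF v, of L lam K] L unfolding G_def Y_def z_def by simp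
  have a0: "?a K = 0" if "K < - int B" for K
    using that by (intro sum.neutral) (auto simp: series_term_def)
  have b0: "?b K = 0" if "K < - int L" for K
    using that by (intro sum.neutral) (auto simp: series_term_def)
  have arg: "\<mu> + \<nu> - 2 * of_int N - (\<mu> - 2 * of_int K) = \<nu> - 2 * of_int (N - K)" for K
    by (simp add: algebra_simps)
  have "prod_tens ?gW ?gV (\<mu> + \<nu> - 2 * of_int N) =
      (\<Sum>\<alpha>\<in>(\<lambda>K. \<mu> - 2 * of_int K) ` ?A. ?gW \<alpha> \<otimes>\<^sub>t ?gV (\<mu> + \<nu> - 2 * of_int N - \<alpha>))"
    unfolding prod_tens_def
  proof (rule Sum_any.expand_superset)
    show "{\<alpha>. ?gW \<alpha> \<otimes>\<^sub>t ?gV (\<mu> + \<nu> - 2 * of_int N - \<alpha>) \<noteq> 0} \<subseteq> (\<lambda>K. \<mu> - 2 * of_int K) ` ?A"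
    proof
      fix \<alpha> assume "\<alpha> \<in> {\<alpha>. ?gW \<alpha> \<otimes>\<^sub>t ?gV (\<mu> + \<nu> - 2 * of_int N - \<alpha>) \<noteq> 0}"
      then have nz: "?gW \<alpha> \<noteq> 0" "?gV (\<mu> + \<nu> - 2 * of_int N - \<alpha>) \<noteq> 0"
        by (auto simp: tens_linear)
      then obtain K where K: "\<alpha> = \<mu> - 2 * of_int K" using W.gen_act_Mq_off [OF w] by blast
      have "- int B \<le> K" "- int L \<le> N - K"
        using nz a0 [of K] b0 [of "N - K"] unfolding K arg gW gV by force+
      then show "\<alpha> \<in> (\<lambda>K. \<mu> - 2 * of_int K) ` ?A" unfolding K by auto
    qed
  qed simp
  also have "\<dots> = (\<Sum>K\<in>?A. ?a K \<otimes>\<^sub>t ?b (N - K))"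
    by (subst sum.reindex) (auto simp: inj_on_def arg gW gV simp del: of_int_diff)
  also have "\<dots> = (\<Sum>J<L. \<Sum>K\<in>?A. (?c J *\<^sub>C ?a K) \<otimes>\<^sub>t series_term (Eq_coeff q) G (int J + (N
      - K)) ((Y ^^ J) v))"
    by (subst sum.swap) (simp add: tens_linear)
  also have "\<dots> = (\<Sum>J<L. \<Sum>b<R. Eq_coeff q b *\<^sub>C ((?c J *\<^sub>C ?a (N + int J - int b))
      \<otimes>\<^sub>t (G ^^ b) ((Y ^^ J) v)))"
  proof (rule sum.cong [OF refl])
    fix J assume "J \<in> {..<L}"
    then have J: "J < L" by simp
    let ?h = "\<lambda>K. (?c J *\<^sub>C ?a K) \<otimes>\<^sub>t series_term (Eq_coeff q) G (int J + (N - K)) ((Y ^^ J) v)"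
    have "?h (N + int J - int b) = Eq_coeff q b *\<^sub>C ((?c J *\<^sub>C ?a (N + int J - int b))
        \<otimes>\<^sub>t (G ^^ b) ((Y ^^ J) v))" for b
      \<comment> \<open>Only the scalar of the second slot is pulled out; \<open>?c J\<close> stays
        inside the first.\<close>
      by (simp add: series_term_int [of b] tens_linear(2) del: tens_linear(7))
    then have "(\<Sum>b<R. Eq_coeff q b *\<^sub>C ((?c J *\<^sub>C ?a (N + int J - int b)) \<otimes>\<^sub>t (G ^^ b) ((Y ^^ J) v)))
        = (\<Sum>b<R. ?h (N + int J - int b))" by simp
    also have "\<dots> = sum ?h ((\<lambda>b. N + int J - int b) ` {..<R})"
      by (subst sum.reindex) (auto simp: inj_on_def)
    also have "\<dots> = sum ?h ?A"
    \<comment> \<open>Indices only in \<open>?A\<close> have K > N + J, a negative exponent of G;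
      indices only in the image have K < -B, where \<open>?a K\<close> is zero.\<close>
    proof (rule sum.mono_neutral_cong)
      fix K assume K: "K \<in> ?A - (\<lambda>b. N + int J - int b) ` {..<R}"
      have "int J + (N - K) < 0"
      proof (rule ccontr)
        assume "\<not> int J + (N - K) < 0"
        moreover from this have "nat (int J + (N - K)) < R \<or> int J + (N - K) \<ge> int R" by linarith
        moreover have "int J + (N - K) < int R" using K J R by auto
        ultimately have "K = N + int J - int (nat (int J + (N - K)))" "nat (int J + (N - K))
            \<in> {..<R}" by auto
        then show False using K by blast
      qed
      then show "?h K = 0" by (simp add: series_term_def tens_linear)
    next
      fix K assume "K \<in> (\<lambda>b. N + int J - int b) ` {..<R} - ?A"
      then have "K < - int B" using J by auto
      then show "?h K = 0" by (simp only: a0 cvec.scale_zero_right tens_linear)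
    qed auto
    finally show "sum ?h ?A = (\<Sum>b<R. Eq_coeff q b *\<^sub>C ((?c J *\<^sub>C ?a (N + int J - int b))
        \<otimes>\<^sub>t (G ^^ b) ((Y ^^ J) v)))"
      by simp
  qed
  finally show ?thesis by (simp only: add.commute [of "int _"])
qed

lemma fusion:
  assumes w: "w \<in> weight_space W \<mu>" and v: "v \<in> weight_space V \<nu>"
    and "lam - \<nu> \<notin> resonant q" "lam - \<nu> - \<mu> \<notin> resonant q"
  shows "gen_act (uq_tensor q W V) (Mq q lam) (Jq q lam W V (w \<otimes>\<^sub>t v)) =
    prod_tens (gen_act W (Mq q (lam - \<nu>)) w) (gen_act V (Mq q lam) v)"
proof
  fix \<kappa>
  let ?T = "uq_tensor q W V" and ?X = "arg_f q (lam - \<nu>) W" and ?Y = "arg_y q lam V"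
  let ?P = "arg_y q (lam - \<nu>) W"
  obtain L where "\<And>l m s. l \<le> 0 \<Longrightarrow> m \<ge> L \<Longrightarrow> s \<in> weight_space V (\<nu> - 2 * of_nat l) \<Longrightarrow> (?Y ^^ m) s = 0"
    using V.arg_y_nilpotent by blast
  from this [of 0] v have L: "\<And>l. l \<ge> L \<Longrightarrow> (?Y ^^ l) v = 0" by simp
  \<comment> \<open>\<open>B\<close> is chosen after \<open>L\<close>, since it has to annihilate
    X^l w for every l up to \<open>L\<close>.\<close>
  obtain B where "\<And>l m s. l \<le> L \<Longrightarrow> m \<ge> B \<Longrightarrow> s \<in> weight_space W (\<mu> - 2 * of_nat l) \<Longrightarrow> (?P ^^ m) s = 0"
    using W.arg_y_nilpotent by blast
  then have B: "\<And>l m. l \<le> L \<Longrightarrow> m \<ge> B \<Longrightarrow> (?P ^^ m) ((?X ^^ l) w) = 0"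
    using W.arg_f_funpow_weight [OF w] by blast
  have z0: "qpoch q (qpow q (\<nu> - lam)) n \<noteq> 0" for n
    using W.qpoch_nonresonant [OF assms(3), of n] by simp
  have "- (lam - \<nu> - \<mu>) = \<mu> + \<nu> - lam" by simp
  then have u0: "qpoch q (qpow q (\<mu> + \<nu> - lam)) n \<noteq> 0" for n
    using W.qpoch_nonresonant [OF assms(4), of n] by (simp only: not_False_eq_True)
  show "gen_act ?T (Mq q lam) (Jq q lam W V (w \<otimes>\<^sub>t v)) \<kappa> =
    prod_tens (gen_act W (Mq q (lam - \<nu>)) w) (gen_act V (Mq q lam) v) \<kappa>"
  proof (cases "\<exists>N. \<kappa> = \<mu> + \<nu> - 2 * of_int N")
    case True
    then obtain N where N: "\<kappa> = \<mu> + \<nu> - 2 * of_int N" by blast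
    \<comment> \<open>\<open>nat\<close> cuts off at 0, and the bound N + L + B <= R required by
      both component lemmas holds in either case.\<close>
    let ?R = "nat (N + int L + int B)"
    note left = fusion_left_component [where L = L and B = B and N = N and R = ?R, OF w v z0 u0]
    note right = fusion_right_component [where L = L and B = B and N = N and R = ?R, OF w v]
    show ?thesis
      unfolding N
      by (rule trans [OF left right [symmetric]]) (use B B [of 0] L in auto)
  next
    case False
    have J: "Jq q lam W V (w \<otimes>\<^sub>t v) \<in> weight_space ?T (\<mu> + \<nu>)"
      by (rule Jq_weight [OF w v L])
    \<comment> \<open>Two nonzero components would have weights in \<mu> - 2K and \<nu> - 2K', whose
      sum puts \<kappa> back on the excluded lattice.\<close>
    have "gen_act W (Mq q (lam - \<nu>)) w \<alpha> = 0 \<or> gen_act V (Mq q lam) v (\<kappa> - \<alpha>) = 0" for \<alpha>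
    proof (rule disjCI, rule ccontr)
      assume "gen_act V (Mq q lam) v (\<kappa> - \<alpha>) \<noteq> 0" "gen_act W (Mq q (lam - \<nu>)) w \<alpha> \<noteq> 0"
      then obtain K K' where "\<alpha> = \<mu> - 2 * of_int K" "\<kappa> - \<alpha> = \<nu> - 2 * of_int K'"
        using W.gen_act_Mq_off [OF w] V.gen_act_Mq_off [OF v] by metis
      moreover have "\<kappa> = \<alpha> + (\<kappa> - \<alpha>)" by simp
      ultimately have "\<kappa> = \<mu> + \<nu> - 2 * of_int (K + K')" by simp
      with False show False by blast
    qed
    then have "gen_act W (Mq q (lam - \<nu>)) w \<alpha> \<otimes>\<^sub>t gen_act V (Mq q lam) v (\<kappa> - \<alpha>) = 0" for \<alpha>
      by (metis tens_linear(3,8))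
    then show ?thesis
      using T.gen_act_Mq_off [OF J] False by (simp add: prod_tens_def)
  qed
qed

end

theorem theorem7p1:
  fixes q :: real
    and W :: "'w::complex_vector uq_ops"
    and V :: "'v::complex_vector uq_ops"
    and U :: "'u::complex_vector uq_ops"
  assumes "0 < q" and "q < 1"
    and "uq_module q W" and "uq_module q V" and "uq_module q U"
  shows
    "(\<forall>lam \<mu> \<nu> w v.
        weight_vector W \<mu> w \<longrightarrow> weight_vector V \<nu> v \<longrightarrow>
        lam - \<nu> \<notin> resonant q \<longrightarrow> lam - \<nu> - \<mu> \<notin> resonant q \<longrightarrow>
        gen_act (uq_tensor q W V) (Mq q lam) (Jq q lam W V (w \<otimes>\<^sub>t v)) =
        prod_tens (gen_act W (Mq q (lam - \<nu>)) w) (gen_act V (Mq q lam) v))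
     \<and> (\<forall>lam \<mu> u.
        weight_vector U \<mu> u \<longrightarrow> lam - \<mu> \<notin> resonant q \<longrightarrow>
        gen_act U (Mq q lam) u =
        fps_act U (Eq_series q) (arg_f q lam U) (Aq_act q U (arg_x q lam) (arg_y q lam U) u))
     \<and> (\<forall>lam u.
        fun_h U (arg_x q lam) (arg_y q lam U u) =
        (complex_of_real q)\<^sup>2 *\<^sub>C arg_y q lam U (fun_h U (arg_x q lam) u))"
proof -
  have base: "q_base q" using assms(1,2) by (rule q_base.intro)
  interpret WV: q_module_pair q W V
    using base assms(3,4) by (intro q_module_pair.intro q_module.intro q_module_axioms.intro)
  interpret U: q_module q U
    using base assms(5) by (intro q_module.intro q_module_axioms.intro)
  have factorization: "gen_act U (Mq q lam) u =
      fps_act U (Eq_series q) (arg_f q lam U) (Aq_act q U (arg_x q lam) (arg_y q lam U) u)"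
    if u: "u \<in> weight_space U \<mu>" for lam \<mu> u
  proof -
    obtain B where "\<And>l m s. l \<le> 0 \<Longrightarrow> m \<ge> B \<Longrightarrow> s \<in> weight_space U (\<mu> - 2 * of_nat l) \<Longrightarrow>
        (arg_y q lam U ^^ m) s = 0"
      using U.arg_y_nilpotent by blast
    from this [of 0] u have "\<And>m. m \<ge> B \<Longrightarrow> (arg_y q lam U ^^ m) u = 0" by simp
    with u show ?thesis by (rule U.Mq_factorization)
  qed
  show ?thesis
    unfolding weight_vector_def
    using WV.fusion factorization U.arg_x_arg_y by blast
qed

end
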